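(* Let $K$ be a connected 4-regular simple graph with an odd number of vertices, and let $v$ and $w$ be vertices of $K$. Then $c_2^{(2)}(K-v) = c_2^{(2)}(K-w)$.
   Context: For a graph $G$, assign a variable $a_e$ to each edge $e$ and let the Kirchhoff polynomial be $\Psi_G=\sum_T\prod_{e\notin T}a_e$, where the sum runs over all spanning trees $T$ of $G$. For a prime $p$ and a connected graph $G$ with at least 3 vertices, let $[\Psi_G]_p$ be the number of $\mathbb{F}_p$-rational points of the affine variety $\{\Psi_G=0\}\subseteq \mathbb{F}_p^{|E(G)|}$. The $c_2$ invariant is $c_2^{(p)}(G)=[\Psi_G]_p/p^2 \bmod p$ (this is known to be well defined). $K-v$ denotes $K$ with the vertex $v$ and its incident edges removed. *)

theory Defs
  imports Main "HOL-Library.FuncSet"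
begin

definition simple_graph :: "'a set \<Rightarrow> 'a set set \<Rightarrow> bool" where
  "simple_graph V E \<longleftrightarrow> finite V \<and> (\<forall>e\<in>E. e \<subseteq> V \<and> card e = 2)"

definition degree :: "'a set set \<Rightarrow> 'a \<Rightarrow> nat" where
  "degree E v = card {e\<in>E. v \<in> e}"

definition regular :: "nat \<Rightarrow> 'a set \<Rightarrow> 'a set set \<Rightarrow> bool" where
  "regular k V E \<longleftrightarrow> (\<forall>v\<in>V. degree E v = k)"

definition adj :: "'a set set \<Rightarrow> 'a \<Rightarrow> 'a \<Rightarrow> bool" where
  "adj E u w \<longleftrightarrow> {u, w} \<in> E"

definition connected_graph :: "'a set \<Rightarrow> 'a set set \<Rightarrow> bool" where
  "connected_graph V E \<longleftrightarrow> V \<noteq> {} \<and> (\<forall>u\<in>V. \<forall>w\<in>V. (adj E)\<^sup>*\<^sup>* u w)"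

definition spanning_trees :: "'a set \<Rightarrow> 'a set set \<Rightarrow> 'a set set set" where
  "spanning_trees V E = {T. T \<subseteq> E \<and> connected_graph V T \<and> card T = card V - 1}"

definition kirchhoff :: "'a set \<Rightarrow> 'a set set \<Rightarrow> ('a set \<Rightarrow> int) \<Rightarrow> int" where
  "kirchhoff V E a = (\<Sum>T\<in>spanning_trees V E. \<Prod>e\<in>E - T. a e)"

text \<open>Number of F_p-points of the affine hypersurface Psi_G = 0 in F_p^E
  (F_p represented by the residues 0..p-1).\<close>

definition kirchhoff_points :: "nat \<Rightarrow> 'a set \<Rightarrow> 'a set set \<Rightarrow> nat" where
  "kirchhoff_points p V E =
     card {a \<in> E \<rightarrow>\<^sub>E {0..<int p}. int p dvd kirchhoff V E a}"

definition c2 :: "nat \<Rightarrow> 'a set \<Rightarrow> 'a set set \<Rightarrow> nat" where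
  "c2 p V E = (kirchhoff_points p V E div p ^ 2) mod p"

definition del_vertex_V :: "'a set \<Rightarrow> 'a \<Rightarrow> 'a set" where
  "del_vertex_V V v = V - {v}"

definition del_vertex_E :: "'a set set \<Rightarrow> 'a \<Rightarrow> 'a set set" where
  "del_vertex_E E v = {e\<in>E. v \<notin> e}"

end

(*
  Adjacent vertices v, w suffice. Let H = K - {v, w} and let N be the set of the three neighbours
  of w other than v. Over F_2, expanding Psi_{K-v} around the 3-valent vertex w gives
    c_2(K - v) = #{T : T spanning tree of H, E(H) - T spanning 2-forest separating N}  mod 2,
  because the spanning forest polynomials satisfy f0 f123 = f1 f2 + f1 f3 + f2 f3; this identity
  comes from the uniqueness of harmonic functions with positive weights (coordinates 0 are replaced
  by 2, which keeps parities).

  Write F = E(H) - T, let P be the side of F not containing a fixed vertex r, let cut be the number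
  of edges leaving P, and let a, b be the numbers of elements of P in the two 3-sets N_w, N_v.
  Summing over all such T modulo 2:
    - moving an edge e of T that crosses P from T to F, and its partners, is an involution; it yields
      sum [i in P] = 0 and sum cut * [i in P] = 0 for each vertex i;
    - a cycle crosses any cut an even number of times; regrouping by T + g respectively F + e + f
      yields sum (cut choose 2) = sum |F|, and |F| is odd because |V(K)| is;
    - regrouping by T - e yields sum #{e in T : e inside P} = 0.
  Since 4 |P| = a + b + 2 #{e inside P} + cut, these give sum ((a + b) choose 2) = 0 and
  sum a b = 0, while F separates N_w iff (a choose 2) + a is odd, and likewise for N_v and b.
*)

theory Submission
  imports Defs Complex_Main "HOL-Library.Z2"
begin

section \<open>Forests and connectivity\<close>

text \<open>Let n = |V(H)|. Summing a polynomial over all points of F_2^E keeps, modulo 2, only the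
  monomials in which every variable occurs. Since |E(H)| = 2n - 3 = (n - 1) + (n - 2), the tree
  polynomial times a 2-forest polynomial has exactly degree |E(H)|, and what survives are the
  complementary pairs (T, F). The splittings that separate N_w and those that separate N_v are not
  matched by a bijection; only sums of a, b and cut over all splittings are computed. The obstacle
  is the mixed term in ((a + b) choose 2) = (a choose 2) + (b choose 2) + a b. It is removed by cut
  = a + b modulo 2: multiplying by a gives cut * a = a + a b, and the sums of cut * a and of a
  vanish. Oddness of n enters twice. It makes |F| = n - 2 odd, so that the sum of (cut choose 2) is
  the number of splittings, and this number cancels against the -1 in the count |P| - 1 of the edges
  of F inside P. It also excludes an empty F, which would be a fixed point of the exchange of an
  edge.\<close>

definition conn :: "'a set set \<Rightarrow> 'a \<Rightarrow> 'a \<Rightarrow> bool" where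
  "conn A = (adj A)\<^sup>*\<^sup>*"

lemma conn_refl [simp]: "conn A x x"
  by (simp add: conn_def)

lemma conn_step: "conn A x y \<Longrightarrow> {y, z} \<in> A \<Longrightarrow> conn A x z"
  unfolding conn_def by (erule rtranclp.rtrancl_into_rtrancl) (simp add: adj_def)

lemma conn_edge: "{x, y} \<in> A \<Longrightarrow> conn A x y"
  by (rule conn_step[of _ _ x]) simp_all

lemma conn_induct [consumes 1, case_names refl step]:
  assumes "conn A x y" "Q x" "\<And>y z. conn A x y \<Longrightarrow> {y, z} \<in> A \<Longrightarrow> Q y \<Longrightarrow> Q z"
  shows "Q y"
  using assms(1)[unfolded conn_def] assms(2)
  by (induction rule: rtranclp_induct) (use assms(3) in \<open>auto simp: conn_def adj_def\<close>)

lemma conn_trans: "conn A x y \<Longrightarrow> conn A y z \<Longrightarrow> conn A x z"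
  unfolding conn_def by (rule rtranclp_trans)

lemma conn_sym: "conn A x y \<Longrightarrow> conn A y x"
proof (induction rule: conn_induct)
  case (step y z)
  then have "conn A z y" by (simp add: conn_edge insert_commute)
  then show ?case using step.IH by (rule conn_trans)
qed simp

lemma conn_cong: "conn A x y \<Longrightarrow> conn A r x \<longleftrightarrow> conn A r y"
  using conn_sym conn_trans by metis

lemma conn_mono:
  assumes "conn A x y" "A \<subseteq> B"
  shows "conn B x y"
  using assms(1) by (induction rule: conn_induct) (use assms(2) in \<open>auto intro: conn_step\<close>)

lemma conn_insert:
  "conn (insert {u, v} A) x y \<longleftrightarrow>
     conn A x y \<or> (conn A x u \<and> conn A v y) \<or> (conn A x v \<and> conn A u y)"
  (is "?L \<longleftrightarrow> ?R")
proof
  assume ?L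
  then show ?R
  proof (induction rule: conn_induct)
    case (step y z)
    from step.hyps(2) consider "{y, z} \<in> A" | "y = u" "z = v" | "y = v" "z = u"
      by (auto simp: doubleton_eq_iff)
    then show ?case
    proof cases
      case 1
      then show ?thesis using step.IH by (meson conn_step)
    next
      case 2
      then show ?thesis using step.IH by auto
    next
      case 3
      then show ?thesis using step.IH by auto
    qed
  qed simp
next
  assume ?R
  moreover have "conn (insert {u, v} A) u v"
    by (simp add: conn_edge)
  moreover have "conn (insert {u, v} A) a b" if "conn A a b" for a b
    using that by (rule conn_mono) auto
  ultimately show ?L
    by (meson conn_sym conn_trans)
qed

lemma conn_preserved:
  assumes "conn A x y" and "\<And>u v. {u, v} \<in> A \<Longrightarrow> Q u \<Longrightarrow> Q v" and "Q x"
  shows "Q y"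
  using assms(1,3) by (induction rule: conn_induct) (use assms(2) in auto)

lemma conn_isolated:
  assumes "conn A w x" and "\<And>e. e \<in> A \<Longrightarrow> w \<notin> e"
  shows "x = w"
  by (rule conn_preserved[OF assms(1)]) (use assms(2) in auto)

section \<open>Forests as independent edge sets, and their rank\<close>

lemma simple_graph_finite:
  assumes "simple_graph V E"
  shows "finite V" "finite E"
  using assms finite_subset[of E "Pow V"] by (auto simp: simple_graph_def)

lemma simple_graph_subset: "simple_graph V E \<Longrightarrow> A \<subseteq> E \<Longrightarrow> simple_graph V A"
  by (auto simp: simple_graph_def)

lemma simple_graph_edgeE:
  assumes "simple_graph V E" "e \<in> E"
  obtains x y where "e = {x, y}" "x \<noteq> y" "x \<in> V" "y \<in> V"
  using assms by (force simp: simple_graph_def card_2_iff)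

text \<open>Independence in the cycle matroid, phrased as "every edge is a bridge". Cycles then
  never have to be represented as objects.\<close>

definition indep :: "'a set set \<Rightarrow> bool" where
  "indep A \<longleftrightarrow> (\<forall>x y. {x, y} \<in> A \<longrightarrow> \<not> conn (A - {{x, y}}) x y)"

lemma indep_empty [simp]: "indep {}"
  by (simp add: indep_def)

lemma indep_subset:
  assumes "indep B" "A \<subseteq> B"
  shows "indep A"
  unfolding indep_def
proof (intro allI impI notI)
  fix x y assume "{x, y} \<in> A" "conn (A - {{x, y}}) x y"
  moreover from this(2) have "conn (B - {{x, y}}) x y"
    by (rule conn_mono) (use assms(2) in auto)
  ultimately show False using assms by (auto simp: indep_def)
qed

lemma indep_insert:
  assumes "{u, v} \<notin> A"
  shows "indep (insert {u, v} A) \<longleftrightarrow> indep A \<and> \<not> conn A u v"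
proof
  assume L: "indep (insert {u, v} A)"
  then show "indep A \<and> \<not> conn A u v"
    using indep_subset[OF L, of A] assms by (auto simp: indep_def)
next
  assume R: "indep A \<and> \<not> conn A u v"
  show "indep (insert {u, v} A)"
    unfolding indep_def
  proof (intro allI impI notI)
    fix x y assume xy: "{x, y} \<in> insert {u, v} A" and c: "conn (insert {u, v} A - {{x, y}}) x y"
    show False
    proof (cases "{x, y} = {u, v}")
      case True
      then have "insert {u, v} A - {{x, y}} = A" using assms by auto
      with c have "conn A x y" by simp
      with True R show False by (auto simp: doubleton_eq_iff dest: conn_sym)
    next
      case False
      then have xyA: "{x, y} \<in> A" and eq: "insert {u, v} A - {{x, y}} = insert {u, v} (A - {{x, y}})"
        using xy by auto
      let ?A = "A - {{x, y}}"
      have nc: "\<not> conn ?A x y" using R xyA by (auto simp: indep_def)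
      then have "(conn ?A x u \<and> conn ?A v y) \<or> (conn ?A x v \<and> conn ?A u y)"
        using c unfolding eq conn_insert by blast
      then have "(conn A x u \<and> conn A v y) \<or> (conn A x v \<and> conn A u y)"
        by (meson Diff_subset conn_mono)
      with conn_edge[OF xyA] R show False by (meson conn_sym conn_trans)
    qed
  qed
qed

lemma indep_remove_conn:
  assumes "indep A" "{u, v} \<in> A"
  shows "\<not> conn (A - {{u, v}}) u v"
  using assms by (auto simp: indep_def)

definition separated :: "'a set set \<Rightarrow> 'a set \<Rightarrow> bool" where
  "separated A S \<longleftrightarrow> (\<forall>r\<in>S. \<forall>s\<in>S. conn A r s \<longrightarrow> r = s)"

text \<open>\<open>S\<close> holds one vertex of each component, so this is the rank formula for
  forests. In the induction over edges, deleting an edge cuts one of its ends off from the old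
  representative, and that end becomes an additional representative; the auxiliary claim is stated
  for both orientations of the edge.\<close>

lemma rank_spanning:
  assumes "simple_graph V A" "indep A" "S \<subseteq> V" "separated A S" "\<forall>x\<in>V. \<exists>r\<in>S. conn A x r"
  shows "card A + card S = card V"
proof -
  have "finite A" using simple_graph_finite assms(1) by blast
  then show ?thesis using assms
  proof (induction A arbitrary: S rule: finite_induct)
    case empty
    have "x = y" if "conn {} x y" for x y :: 'a
      using conn_isolated[OF that] by simp
    then have "S = V" using empty by blast
    then show ?case by simp
  next
    case (insert e A)
    note IH = insert.IH
    from insert.prems(1) obtain x y where e: "e = {x, y}" "x \<noteq> y" "x \<in> V" "y \<in> V"
      by (rule simple_graph_edgeE) auto
    have iA: "indep A" "\<not> conn A x y"
      using indep_insert[of x y A] insert.prems(2) insert.hyps(2) e by auto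
    have *: "card (insert e A) + card S = card V"
      if e: "e = {x, y}" "x \<noteq> y" "x \<in> V" "y \<in> V" and nc: "\<not> conn A x y"
        and s: "s \<in> S" "conn A x s" for x y s
    proof -
      have old: "conn (insert e A) u v" if "conn A u v" for u v
        using that by (rule conn_mono) auto
      have exy: "conn (insert e A) x y" using e by (simp add: conn_edge)
      have yS: "\<not> conn A y r" if "r \<in> S" for r
      proof
        assume a: "conn A y r"
        then have "conn (insert e A) s r"
          using old[OF a] old[OF s(2)] exy by (meson conn_sym conn_trans)
        then have "s = r" using insert.prems(4) s that by (auto simp: separated_def)
        then show False using a s nc by (meson conn_sym conn_trans)
      qed
      have "card A + card (insert y S) = card V"
      proof (rule IH)
        show "simple_graph V A" using insert.prems(1) by (rule simple_graph_subset) auto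
        show "indep A" by (fact iA)
        show "insert y S \<subseteq> V" using insert.prems e by auto
        show "separated A (insert y S)"
          using insert.prems(4) old yS unfolding separated_def by (auto dest: conn_sym)
        show "\<forall>z\<in>V. \<exists>r\<in>insert y S. conn A z r"
        proof
          fix z assume "z \<in> V"
          then obtain r where r: "r \<in> S" "conn (insert e A) z r" using insert.prems by blast
          then have "conn A z r \<or> conn A z y \<or> conn A z x"
            unfolding e conn_insert by auto
          then show "\<exists>r\<in>insert y S. conn A z r"
            using r s by (auto intro: conn_trans)
        qed
      qed
      moreover have "y \<notin> S" using yS[of y] by auto
      moreover have "finite S"
        using insert.prems simple_graph_finite(1) finite_subset by blast
      ultimately show ?thesis using insert.hyps by simp
    qed
    from insert.prems(5) e obtain r where r: "r \<in> S" "conn (insert e A) x r" by blast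
    then have "conn A x r \<or> conn A y r" unfolding e(1) conn_insert by auto
    then show ?case
    proof
      assume "conn A x r"
      then show ?thesis using *[OF e iA(2) r(1)] by blast
    next
      assume "conn A y r"
      moreover have "\<not> conn A y x" using iA(2) conn_sym[of A y x] by blast
      ultimately show ?thesis using *[of y x r] e r(1) by (auto simp: insert_commute)
    qed
  qed
qed

lemma separated_extend:
  assumes "finite V" "S \<subseteq> V" "separated A S"
  obtains S' where "S \<subseteq> S'" "S' \<subseteq> V" "separated A S'" "\<forall>x\<in>V. \<exists>r\<in>S'. conn A x r"
proof -
  define X where "X = {S'. S \<subseteq> S' \<and> S' \<subseteq> V \<and> separated A S'}"
  have "finite X" by (rule finite_subset[of _ "Pow V"]) (use assms in \<open>auto simp: X_def\<close>)
  moreover have "X \<noteq> {}" using assms by (auto simp: X_def)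
  ultimately have "\<exists>S'\<in>X. \<forall>R\<in>X. S' \<subseteq> R \<longrightarrow> S' = R" by (rule finite_has_maximal)
  then obtain S' where S': "S' \<in> X" and max: "\<And>R. R \<in> X \<Longrightarrow> S' \<subseteq> R \<Longrightarrow> S' = R"
    by blast
  have "\<exists>r\<in>S'. conn A x r" if "x \<in> V" for x
  proof (rule ccontr)
    assume n: "\<not> (\<exists>r\<in>S'. conn A x r)"
    then have "insert x S' \<in> X"
      using S' that by (auto simp: X_def separated_def dest: conn_sym)
    with max have "x \<in> S'" by blast
    with n conn_refl[of A x] show False by metis
  qed
  with S' that show thesis by (auto simp: X_def)
qed

text \<open>Completing \<open>S\<close> to one vertex per component can only enlarge it, and the
  rank formula applies to the completed set.\<close>

lemma rank_le:
  assumes "simple_graph V A" "indep A" "S \<subseteq> V" "separated A S"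
  shows "card A + card S \<le> card V"
proof -
  have f: "finite V" using assms simple_graph_finite by blast
  obtain S' where S': "S \<subseteq> S'" "S' \<subseteq> V" "separated A S'" "\<forall>x\<in>V. \<exists>r\<in>S'. conn A x r"
    using separated_extend[OF f assms(3,4)] .
  have "card A + card S' = card V" using rank_spanning assms S' by blast
  moreover have "card S \<le> card S'" using S' f by (meson card_mono finite_subset)
  ultimately show ?thesis by simp
qed

lemma rank_eq_spanning:
  assumes "simple_graph V A" "indep A" "S \<subseteq> V" "separated A S" "card A + card S = card V" "x \<in> V"
  shows "\<exists>r\<in>S. conn A x r"
proof -
  have f: "finite V" using assms simple_graph_finite by blast
  obtain S' where S': "S \<subseteq> S'" "S' \<subseteq> V" "separated A S'" "\<forall>x\<in>V. \<exists>r\<in>S'. conn A x r"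
    using separated_extend[OF f assms(3,4)] .
  have "card A + card S' = card V" using rank_spanning assms S' by blast
  then have "S = S'" using S' f assms by (metis add_left_cancel card_subset_eq finite_subset)
  with S' assms show ?thesis by blast
qed

text \<open>A minimal connected subset of a spanning tree has only bridges, hence by the rank
  formula already all |V| - 1 edges. Conversely, a forest of this size leaves room for a single
  component.\<close>

lemma spanning_trees_indep:
  assumes "simple_graph V E" "V \<noteq> {}"
  shows "spanning_trees V E = {T. T \<subseteq> E \<and> indep T \<and> card T + 1 = card V}"
proof (intro set_eqI iffI)
  fix T assume "T \<in> spanning_trees V E"
  then have T: "T \<subseteq> E" "connected_graph V T" "card T = card V - 1"
    by (auto simp: spanning_trees_def)
  have sg: "simple_graph V T" using assms(1) T(1) by (rule simple_graph_subset)
  have fin: "finite T" "finite V" using simple_graph_finite[OF sg] by auto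
  define X where "X = {B. B \<subseteq> T \<and> connected_graph V B}"
  have "finite X" by (rule finite_subset[of _ "Pow T"]) (use fin in \<open>auto simp: X_def\<close>)
  moreover have "X \<noteq> {}" using T by (auto simp: X_def)
  ultimately have "\<exists>B\<in>X. \<forall>R\<in>X. R \<subseteq> B \<longrightarrow> B = R" by (rule finite_has_minimal)
  then obtain B where B: "B \<in> X" and min: "\<And>R. R \<in> X \<Longrightarrow> R \<subseteq> B \<Longrightarrow> B = R"
    by blast
  have "indep B"
    unfolding indep_def
  proof (intro allI impI notI)
    fix x y assume xy: "{x, y} \<in> B" "conn (B - {{x, y}}) x y"
    have "insert {x, y} (B - {{x, y}}) = B" using xy by auto
    then have "conn (B - {{x, y}}) u v" if "conn B u v" for u v
      using conn_insert[of x y "B - {{x, y}}" u v] that xy(2) conn_sym[OF xy(2)] by (metis conn_trans \<open>insert {x, y} (B - {{x, y}}) = B\<close>)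
    then have "B - {{x, y}} \<in> X" using B by (auto simp: X_def connected_graph_def conn_def)
    with min have "B = B - {{x, y}}" by blast
    with xy show False by blast
  qed
  moreover obtain c where c: "c \<in> V" using assms(2) by blast
  moreover have "simple_graph V B" using sg B by (auto simp: X_def intro: simple_graph_subset)
  ultimately have "card B + card {c} = card V"
    using B by (intro rank_spanning) (auto simp: X_def separated_def connected_graph_def conn_def)
  then have "card B = card T" using T(3) by simp
  then have "B = T" using B fin by (auto simp: X_def card_subset_eq)
  with \<open>indep B\<close> \<open>card B + card {c} = card V\<close> T show "T \<in> {T. T \<subseteq> E \<and> indep T \<and> card T + 1 = card V}"
    by simp
next
  fix T assume T: "T \<in> {T. T \<subseteq> E \<and> indep T \<and> card T + 1 = card V}"
  then have sg: "simple_graph V T" using assms(1) simple_graph_subset by blast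
  have "conn T x y" if "x \<in> V" "y \<in> V" for x y
    using rank_eq_spanning[OF sg, of "{y}" x] T that by (auto simp: separated_def)
  then show "T \<in> spanning_trees V E"
    using T assms(2) by (auto simp: spanning_trees_def connected_graph_def conn_def)
qed

section \<open>Parity of cuts in forests\<close>

declare add_bit_eq_xor [simp del] mult_bit_eq_and [simp del]
  sum_of_bool_eq [simp del] sum_of_bool_mult_eq [simp del] sum_mult_of_bool_eq [simp del]

lemma bit_add_self [simp]: "(a::bit) + a = 0"
  by (cases a) simp_all

lemma bit_add_eq_0_iff: "(a::bit) + b = 0 \<longleftrightarrow> a = b"
  by (cases a; cases b) simp_all

lemma bit_mult_self [simp]: "(a::bit) * a = a"
  by (cases a) simp_all

lemma of_nat_bit: "(of_nat n :: bit) = of_bool (odd n)"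
  by (induction n) auto

lemma sum_involution_zero:
  fixes g :: "'b \<Rightarrow> bit"
  assumes "finite M"
    and "\<And>m. m \<in> M \<Longrightarrow> \<iota> m \<in> M \<and> \<iota> (\<iota> m) = m \<and> \<iota> m \<noteq> m \<and> g (\<iota> m) = g m"
  shows "sum g M = 0"
  using assms
proof (induction "card M" arbitrary: M rule: less_induct)
  case less
  show ?case
  proof (cases "M = {}")
    case False
    then obtain m where m: "m \<in> M" by blast
    note i = less.prems(2)[OF m]
    let ?M = "M - {m, \<iota> m}"
    have "sum g ?M = 0"
    proof (rule less.hyps)
      show "card ?M < card M" using less.prems(1) m by (intro psubset_card_mono) auto
      show "finite ?M" using less.prems(1) by simp
      fix n assume n: "n \<in> ?M"
      have "\<iota> n \<noteq> m" "\<iota> n \<noteq> \<iota> m" using n i less.prems(2)[of n] by auto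
      then show "\<iota> n \<in> ?M \<and> \<iota> (\<iota> n) = n \<and> \<iota> n \<noteq> n \<and> g (\<iota> n) = g n"
        using n less.prems(2)[of n] by auto
    qed
    moreover have "sum g M = sum g ?M + sum g {m, \<iota> m}"
      using i m by (intro sum.subset_diff less.prems(1)) auto
    moreover have "sum g {m, \<iota> m} = 0" using i by (subst sum.insert) auto
    ultimately show ?thesis by simp
  qed simp
qed

text \<open>Stated for arbitrary sets, because it serves both for edges leaving a vertex set and for
  3-sets of neighbours that do not lie on one side.\<close>

definition crosses :: "('a \<Rightarrow> bool) \<Rightarrow> 'a set \<Rightarrow> bool" where
  "crosses s e \<longleftrightarrow> (\<exists>x\<in>e. \<exists>y\<in>e. s x \<noteq> s y)"

lemma crosses_doubleton [simp]: "crosses s {x, y} \<longleftrightarrow> s x \<noteq> s y"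
  by (auto simp: crosses_def)

text \<open>The path from \<open>i\<close> to \<open>j\<close> in a forest consists of the edges whose removal separates
  \<open>i\<close> from \<open>j\<close>.\<close>

lemma path_parity:
  assumes "simple_graph V A" "indep A" "conn A i j"
  shows "(\<Sum>e\<in>A. of_bool (crosses s e \<and> \<not> conn (A - {e}) i j) :: bit) = of_bool (s i \<noteq> s j)"
  using assms(3)
proof (induction rule: conn_induct)
  case (step j k)
  let ?e = "{j, k}"
  let ?t = "\<lambda>j e. of_bool (crosses s e \<and> \<not> conn (A - {e}) i j) :: bit"
  have fin: "finite A" using assms simple_graph_finite by blast
  \<comment> \<open>The paths from \<open>i\<close> to \<open>j\<close> and from \<open>i\<close> to
    \<open>k\<close> differ only in the edge \<open>{j, k}\<close>, which is either appended or
    retraced; modulo 2 both change the sum by its own term.\<close>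
  have eq: "?t k e = ?t j e" if "e \<in> A - {?e}" for e
  proof -
    have "conn (A - {e}) j k" using that step.hyps by (intro conn_edge) auto
    then have "conn (A - {e}) i j \<longleftrightarrow> conn (A - {e}) i k"
      by (meson conn_sym conn_trans)
    then show ?thesis by simp
  qed
  have ne: "\<not> conn (A - {?e}) j k"
    using assms(2) step.hyps(2) by (rule indep_remove_conn)
  have "conn (insert ?e (A - {?e})) i j" using step.hyps by (simp add: insert_absorb)
  then have "conn (A - {?e}) i j \<or> conn (A - {?e}) i k"
    unfolding conn_insert by blast
  then have "conn (A - {?e}) i k \<longleftrightarrow> \<not> conn (A - {?e}) i j"
    using ne by (meson conn_sym conn_trans)
  then have e: "?t k ?e = ?t j ?e + of_bool (s j \<noteq> s k)" by auto
  have "(\<Sum>e\<in>A. ?t k e) = ?t k ?e + (\<Sum>e\<in>A - {?e}. ?t k e)"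
    using fin step.hyps(2) by (rule sum.remove)
  also have "(\<Sum>e\<in>A - {?e}. ?t k e) = (\<Sum>e\<in>A - {?e}. ?t j e)"
    using eq by (rule sum.cong[OF refl])
  also have "?t k ?e + \<dots> = of_bool (s j \<noteq> s k) + (?t j ?e + (\<Sum>e\<in>A - {?e}. ?t j e))"
    unfolding e by (simp add: ac_simps)
  also have "?t j ?e + (\<Sum>e\<in>A - {?e}. ?t j e) = (\<Sum>e\<in>A. ?t j e)"
    using fin step.hyps(2) by (rule sum.remove[symmetric])
  also have "\<dots> = of_bool (s i \<noteq> s j)" by (fact step.IH)
  finally show ?case by (auto simp: of_bool_def)
qed simp

text \<open>\<open>Z\<close> is a forest plus the edge \<open>{x, y}\<close>, so it has a single
  cycle. Deleting \<open>e\<close> destroys it exactly if \<open>e\<close> lies on the path from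
  \<open>x\<close> to \<open>y\<close> in the forest.\<close>

lemma indep_exchange:
  assumes "\<not> indep Z" "{x, y} \<in> Z" "indep (Z - {{x, y}})" "e \<in> Z" "e \<noteq> {x, y}"
  shows "indep (Z - {e}) \<longleftrightarrow> \<not> conn (Z - {{x, y}} - {e}) x y"
proof -
  let ?A = "Z - {{x, y}} - {e}"
  have "indep ?A" using assms(3) by (rule indep_subset) auto
  moreover have "Z - {e} = insert {x, y} ?A" using assms by auto
  ultimately show ?thesis by (simp add: indep_insert)
qed

text \<open>If \<open>Z\<close> has a single cycle, the edges \<open>e\<close> with
  \<open>Z - {e}\<close> independent are its edges: one edge together with the forest path between
  its ends, to which \<open>path_parity\<close> applies. If no single deletion makes
  \<open>Z\<close> a forest, every term is 0.\<close>

lemma cycle_parity: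
  assumes "simple_graph V Z" "\<not> indep Z"
  shows "(\<Sum>e\<in>Z. of_bool (indep (Z - {e}) \<and> crosses s e) :: bit) = 0"
proof (cases "\<exists>e\<in>Z. indep (Z - {e})")
  case True
  then obtain e where "e \<in> Z" "indep (Z - {e})" by blast
  moreover obtain x y where e: "e = {x, y}"
    using assms(1) \<open>e \<in> Z\<close> by (rule simple_graph_edgeE)
  ultimately have xy: "{x, y} \<in> Z" "indep (Z - {{x, y}})" by auto
  let ?A = "Z - {{x, y}}"
  have fin: "finite Z" using assms simple_graph_finite by blast
  have "insert {x, y} ?A = Z" using xy by auto
  with assms(2) xy have c: "conn ?A x y" using indep_insert[of x y ?A] by auto
  have "simple_graph V ?A" using assms(1) by (rule simple_graph_subset) auto
  then have "(\<Sum>e\<in>?A. of_bool (crosses s e \<and> \<not> conn (?A - {e}) x y) :: bit) = of_bool (s x \<noteq> s y)"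
    using xy(2) c by (rule path_parity)
  moreover have "(\<Sum>e\<in>?A. of_bool (crosses s e \<and> \<not> conn (?A - {e}) x y) :: bit) =
    (\<Sum>e\<in>?A. of_bool (indep (Z - {e}) \<and> crosses s e))"
    using indep_exchange[OF assms(2) xy] by (intro sum.cong) auto
  ultimately show ?thesis
    using sum.remove[OF fin xy(1), of "\<lambda>e. of_bool (indep (Z - {e}) \<and> crosses s e) :: bit"] xy(2)
    by simp
qed (auto intro: sum.neutral)

lemma cycle_conn:
  assumes "\<not> indep Z" "{x, y} \<in> Z" "indep (Z - {{x, y}})" "{u, v} \<in> Z" "indep (Z - {{u, v}})"
  shows "conn Z x u"
proof (cases "{u, v} = {x, y}")
  case True
  then have "conn Z x u" if "u = y" using assms conn_edge that by auto
  then show ?thesis using True by (auto simp: doubleton_eq_iff)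
next
  case False
  let ?A = "Z - {{x, y}}" and ?B = "Z - {{x, y}} - {{u, v}}"
  have "\<not> conn ?B x y" using indep_exchange[OF assms(1-4) False] assms(5) by simp
  moreover have "conn ?A x y"
    using assms indep_insert[of x y ?A] by (auto simp: insert_absorb)
  moreover have "?A = insert {u, v} ?B" using assms False by auto
  ultimately have "conn ?B x u \<or> conn ?B u y"
    using conn_insert[of u v ?B x y] by auto
  moreover have "conn Z p q" if "conn ?B p q" for p q
    using that by (rule conn_mono) auto
  ultimately show ?thesis
    using conn_edge[OF assms(2)] by (meson conn_sym conn_trans)
qed

text \<open>Encoded by size rather than by connectivity, so that an exchange of edges only requires
  a check of independence and a count.\<close>

definition tree :: "'a set \<Rightarrow> 'a set set \<Rightarrow> bool" where
  "tree V T \<longleftrightarrow> indep T \<and> card T + 1 = card V"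

definition two_forest :: "'a set \<Rightarrow> 'a set set \<Rightarrow> bool" where
  "two_forest V F \<longleftrightarrow> indep F \<and> card F + 2 = card V"

lemma tree_conn:
  assumes "simple_graph V T" "tree V T" "x \<in> V" "y \<in> V"
  shows "conn T x y"
  using rank_eq_spanning[OF assms(1), of "{y}" x] assms by (auto simp: separated_def tree_def)

text \<open>Three pairwise unconnected vertices would exceed the bound \<open>rank_le\<close>; hence
  a vertex not joined to \<open>r\<close> lies in the one other component.\<close>

lemma two_forest_conn:
  assumes "simple_graph V F" "two_forest V F" "r \<in> V" "x \<in> V" "y \<in> V"
  shows "conn F x y \<longleftrightarrow> conn F r x = conn F r y"
proof -
  have "conn F x y" if "\<not> conn F r x" "\<not> conn F r y"
  proof (rule ccontr)
    assume "\<not> conn F x y"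
    then have "separated F {r, x, y}" using that by (auto simp: separated_def dest: conn_sym)
    then have "card F + card {r, x, y} \<le> card V"
      using assms by (intro rank_le) (auto simp: two_forest_def)
    moreover have "x \<noteq> y" "r \<noteq> x" "r \<noteq> y" using \<open>\<not> conn F x y\<close> that conn_refl by metis+
    ultimately show False using assms(2) by (auto simp: two_forest_def)
  qed
  then show ?thesis by (meson conn_sym conn_trans)
qed

section \<open>Splittings of the edge set into a spanning tree and a spanning 2-forest\<close>

locale tree_splits =
  fixes V :: "'a set" and E :: "'a set set" and r :: 'a
  assumes graph: "simple_graph V E" and r: "r \<in> V" and odd_V: "odd (card V)"
begin

definition splits :: "'a set set set" where
  "splits = {T. T \<subseteq> E \<and> tree V T \<and> two_forest V (E - T)}"

text \<open>On \<open>V\<close> this is the indicator of P; \<open>r\<close> merely fixes which of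
  the two components of \<open>E - T\<close> is called P.\<close>

definition side :: "'a set set \<Rightarrow> 'a \<Rightarrow> bool" where
  "side T x \<longleftrightarrow> \<not> conn (E - T) r x"

definition cut :: "'a set set \<Rightarrow> 'a set set" where
  "cut T = {e\<in>E. crosses (side T) e}"

lemma finV: "finite V" and finE: "finite E"
  using simple_graph_finite[OF graph] by auto

lemma sub: "A \<subseteq> E \<Longrightarrow> simple_graph V A"
  using graph by (rule simple_graph_subset)

lemma edgeE:
  assumes "e \<in> E"
  obtains x y where "e = {x, y}" "x \<noteq> y" "x \<in> V" "y \<in> V"
  using simple_graph_edgeE[OF graph assms] by blast

lemma fin_splits: "finite splits"
  by (rule finite_subset[of _ "Pow E"]) (auto simp: splits_def finE)

lemma splitsD:
  assumes "T \<in> splits"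
  shows "T \<subseteq> E" "indep T" "card T + 1 = card V" "indep (E - T)" "card (E - T) + 2 = card V"
    "tree V T" "two_forest V (E - T)" "finite T"
  using assms finite_subset[OF _ finE] by (auto simp: splits_def tree_def two_forest_def)

lemma side_conn:
  assumes "T \<in> splits" "x \<in> V" "y \<in> V"
  shows "conn (E - T) x y \<longleftrightarrow> side T x = side T y"
  using two_forest_conn[OF sub splitsD(7)[OF assms(1)] r assms(2,3)] by (auto simp: side_def)

lemma cut_subset:
  assumes "T \<in> splits"
  shows "cut T \<subseteq> T"
proof
  fix e assume e: "e \<in> cut T"
  then have "e \<in> E" by (auto simp: cut_def)
  then obtain x y where xy: "e = {x, y}" "x \<in> V" "y \<in> V" by (rule edgeE)
  show "e \<in> T"
  proof (rule ccontr)
    assume "e \<notin> T"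
    then have "conn (E - T) x y" using xy \<open>e \<in> E\<close> by (intro conn_edge) auto
    then show False using side_conn[OF assms xy(2,3)] e xy by (auto simp: cut_def)
  qed
qed

text \<open>The edge \<open>e\<close> joins the two components of \<open>E - T\<close>, so adding it
  there produces a tree, while deleting it from \<open>T\<close> produces a 2-forest. Tree and
  forest exchange roles, and \<open>e\<close> lies in the new cut because it is a bridge of
  \<open>T\<close>.\<close>

lemma swap:
  assumes "T \<in> splits" "e \<in> cut T"
  shows "insert e (E - T) \<in> splits" "E - insert e (E - T) = T - {e}"
    "e \<in> cut (insert e (E - T))"
proof -
  note T = splitsD[OF assms(1)]
  have eT: "e \<in> T" using assms cut_subset by blast
  then obtain x y where xy: "e = {x, y}" "x \<noteq> y" "x \<in> V" "y \<in> V" using T(1) by (meson edgeE subsetD)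
  show eq: "E - insert e (E - T) = T - {e}" using T(1) by auto
  have "\<not> conn (E - T) x y"
    using side_conn[OF assms(1) xy(3,4)] assms(2) xy(1) by (auto simp: cut_def)
  then have "indep (insert e (E - T))"
    using T(4) eT unfolding xy(1) by (subst indep_insert) auto
  moreover have "card (insert e (E - T)) + 1 = card V"
    using eT finE T(5) by simp
  moreover have "indep (T - {e})" using T(2) by (rule indep_subset) auto
  moreover have "card (T - {e}) + 2 = card V"
    using eT T(3,8) by (metis add_Suc_right card_Suc_Diff1 add_Suc Suc_1 nat_1_add_1 plus_1_eq_Suc)
  ultimately show s: "insert e (E - T) \<in> splits"
    using eT T(1) eq by (auto simp: splits_def tree_def two_forest_def)
  have "\<not> conn (T - {e}) x y"
    using indep_remove_conn[of T x y] T(2) eT xy(1) by auto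
  then have "\<not> conn (E - insert e (E - T)) x y" unfolding eq .
  then show "e \<in> cut (insert e (E - T))"
    using side_conn[OF s xy(3,4)] eT T(1) xy(1) by (auto simp: cut_def)
qed

text \<open>After the exchange of \<open>e\<close>, vertex \<open>i\<close> is far from
  \<open>r\<close> exactly if \<open>e\<close> lies on the path from \<open>r\<close> to
  \<open>i\<close> in \<open>T\<close>. The sum therefore counts how often this path crosses the
  cut, which is odd exactly if \<open>i\<close> is on the far side.\<close>

lemma side_swap_sum:
  assumes "T \<in> splits" "i \<in> V"
  shows "(\<Sum>e\<in>cut T. of_bool (side (insert e (E - T)) i) :: bit) = of_bool (side T i)"
proof -
  note T = splitsD[OF assms(1)]
  have "(\<Sum>e\<in>cut T. of_bool (side (insert e (E - T)) i) :: bit) =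
      (\<Sum>e\<in>cut T. of_bool (crosses (side T) e \<and> \<not> conn (T - {e}) r i))"
    using swap(2)[OF assms(1)] by (intro sum.cong) (auto simp: side_def cut_def)
  also have "\<dots> = (\<Sum>e\<in>T. of_bool (crosses (side T) e \<and> \<not> conn (T - {e}) r i))"
    using cut_subset[OF assms(1)] T by (intro sum.mono_neutral_left) (auto simp: cut_def)
  also have "\<dots> = of_bool (side T r \<noteq> side T i)"
    by (rule path_parity[OF sub[OF T(1)] T(2)]) (use tree_conn[OF sub[OF T(1)] T(6)] r assms in auto)
  finally show ?thesis by (simp add: side_def)
qed

definition swaps :: "('a set set \<times> 'a set) set" where
  "swaps = Sigma splits cut"

definition swap_at :: "'a set set \<times> 'a set \<Rightarrow> 'a set set \<times> 'a set" where
  "swap_at = (\<lambda>(T, e). (insert e (E - T), e))"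

lemma fin_cut [simp]: "finite (cut T)"
  by (simp add: cut_def finE)

lemma fin_swaps: "finite swaps"
  unfolding swaps_def by (rule finite_SigmaI) (auto simp: fin_splits)

lemma swap_at:
  assumes "m \<in> swaps"
  shows "swap_at m \<in> swaps" "swap_at (swap_at m) = m" "swap_at m \<noteq> m"
proof -
  from assms obtain T e where m: "m = (T, e)" "T \<in> splits" "e \<in> cut T" by (auto simp: swaps_def)
  note T = splitsD[OF m(2)] and eT = subsetD[OF cut_subset[OF m(2)] m(3)]
  show "swap_at m \<in> swaps" using swap[OF m(2,3)] m by (auto simp: swap_at_def swaps_def)
  show "swap_at (swap_at m) = m"
    using swap(2)[OF m(2,3)] eT m by (auto simp: swap_at_def)
  show "swap_at m \<noteq> m"
  proof
    assume "swap_at m = m"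
    then have "insert e (E - T) = T" using m by (auto simp: swap_at_def)
    \<comment> \<open>A fixed point would force the 2-forest to be empty, hence |V| = 2, against the
      parity of |V|.\<close>
    then have "E - T = {}" using eT by blast
    then have "card V = 2" using T(5) by (metis add_0 card.empty)
    then show False using odd_V by simp
  qed
qed

text \<open>The indicator is idempotent, so it may be squared, and one factor is replaced using
  \<open>side_swap_sum\<close>. The resulting summand over pairs (T, e) is symmetric in T and its
  exchange partner, and the partners cancel in pairs.\<close>

lemma sum_side: 
  assumes "i \<in> V"
  shows "(\<Sum>T\<in>splits. of_bool (side T i) :: bit) = 0"
proof -
  have "(\<Sum>T\<in>splits. of_bool (side T i) :: bit) = (\<Sum>T\<in>splits. of_bool (side T i) * of_bool (side T i))"
    by simp
  also have "\<dots> = (\<Sum>T\<in>splits. \<Sum>e\<in>cut T. of_bool (side T i) * of_bool (side (insert e (E - T)) i))"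
    using side_swap_sum[OF _ assms] by (intro sum.cong) (auto simp flip: sum_distrib_left)
  also have "\<dots> = (\<Sum>m\<in>swaps. of_bool (side (fst m) i) * of_bool (side (fst (swap_at m)) i))"
    unfolding swaps_def
    by (subst sum.Sigma) (auto simp: fin_splits swap_at_def intro!: sum.cong)
  also have "\<dots> = 0"
    by (rule sum_involution_zero[where \<iota> = swap_at]) (simp_all add: fin_swaps swap_at mult.commute)
  finally show ?thesis .
qed

text \<open>The left side counts pairs (T, e) with \<open>i\<close> far for \<open>T\<close>.
  Reindexing by the exchange lets \<open>side_swap_sum\<close> collapse the inner sum, and
  \<open>sum_side\<close> remains.\<close>

lemma sum_cut_side:
  assumes "i \<in> V"
  shows "(\<Sum>T\<in>splits. of_nat (card (cut T)) * of_bool (side T i) :: bit) = 0"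
proof -
  have "(\<Sum>T\<in>splits. of_nat (card (cut T)) * of_bool (side T i) :: bit) =
      (\<Sum>m\<in>swaps. of_bool (side (fst m) i))"
    unfolding swaps_def
    by (subst sum.Sigma[symmetric, where g = "\<lambda>T e. of_bool (side T i)", simplified case_prod_unfold])
      (auto simp: fin_splits)
  also have "\<dots> = (\<Sum>m\<in>swaps. of_bool (side (fst (swap_at m)) i))"
    by (rule sum.reindex_bij_witness[of _ swap_at swap_at]) (auto simp: swap_at)
  also have "\<dots> = (\<Sum>T\<in>splits. \<Sum>e\<in>cut T. of_bool (side (insert e (E - T)) i))"
    unfolding swaps_def
    by (subst sum.Sigma) (auto simp: fin_splits swap_at_def intro!: sum.cong)
  also have "\<dots> = (\<Sum>T\<in>splits. of_bool (side T i))"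
    using side_swap_sum[OF _ assms] by (intro sum.cong) auto
  finally show ?thesis using sum_side[OF assms] by simp
qed

end

text \<open>Over unordered pairs the symmetrised products add up to the product of the two sums
  without its diagonal; modulo 2 the diagonal appears with a plus sign.\<close>

lemma sum_pairs_bit:
  fixes a b :: "'b \<Rightarrow> bit"
  assumes "finite C" and "\<And>e f. e \<in> C \<Longrightarrow> f \<in> C \<Longrightarrow> e \<noteq> f \<Longrightarrow> h {e, f} = a e * b f + a f * b e"
  shows "(\<Sum>X | X \<subseteq> C \<and> card X = 2. h X) = sum a C * sum b C + (\<Sum>e\<in>C. a e * b e)"
  using assms
proof (induction C rule: finite_induct)
  case empty
  have none: "{X. X \<subseteq> ({} :: 'b set) \<and> card X = 2} = {}" by auto
  show ?case unfolding none by simp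
next
  case (insert c C)
  let ?P = "{X. X \<subseteq> C \<and> card X = 2}" and ?Q = "(\<lambda>e. {c, e}) ` C"
  have inj: "inj_on (\<lambda>e. {c, e}) C"
    by (auto simp: inj_on_def doubleton_eq_iff)
  have "{X. X \<subseteq> insert c C \<and> card X = 2} = ?P \<union> ?Q"
  proof (intro set_eqI iffI)
    fix X assume X: "X \<in> {X. X \<subseteq> insert c C \<and> card X = 2}"
    then obtain p q where pq: "X = {p, q}" "p \<noteq> q" by (auto simp: card_2_iff)
    show "X \<in> ?P \<union> ?Q"
    proof (cases "c \<in> X")
      case True
      then have "X = {c, if p = c then q else p}" "(if p = c then q else p) \<in> C"
        using pq X by auto
      then show ?thesis by blast
    qed (use X in auto)
  next
    fix X assume "X \<in> ?P \<union> ?Q"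
    then show "X \<in> {X. X \<subseteq> insert c C \<and> card X = 2}"
      using insert.hyps(2) by (auto simp: card_2_iff)
  qed
  moreover have "?P \<inter> ?Q = {}" using insert.hyps(2) by auto
  moreover have "finite ?P" using insert.hyps(1) by simp
  ultimately have "(\<Sum>X | X \<subseteq> insert c C \<and> card X = 2. h X) = sum h ?P + sum h ?Q"
    using insert.hyps(1) by (simp add: sum.union_disjoint)
  also have "sum h ?P = sum a C * sum b C + (\<Sum>e\<in>C. a e * b e)"
    using insert.prems by (intro insert.IH) auto
  also have "sum h ?Q = (\<Sum>e\<in>C. h {c, e})"
    by (simp add: sum.reindex[OF inj])
  also have "\<dots> = (\<Sum>e\<in>C. a c * b e + a e * b c)"
    using insert.prems insert.hyps(2) by (intro sum.cong) auto
  also have "\<dots> = a c * sum b C + sum a C * b c"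
    by (simp add: sum.distrib sum_distrib_left sum_distrib_right)
  also have "sum a C * sum b C + (\<Sum>e\<in>C. a e * b e) + \<dots> =
      (a c + sum a C) * (b c + sum b C) + (a c * b c + (\<Sum>e\<in>C. a e * b e))"
  proof -
    have "A * B + S + (x * B + A * y) = (x + A) * (y + B) + (x * y + S)" for A B S x y :: bit
      by (cases A; cases B; cases S; cases x; cases y) simp_all
    then show ?thesis .
  qed
  finally show ?case using insert.hyps by simp
qed

section \<open>Tree edges inside the far side, and pairs of cut edges\<close>

context tree_splits
begin

definition inner :: "'a set set \<Rightarrow> 'a set set" where
  "inner T = {e\<in>T. \<forall>x\<in>e. side T x}"

text \<open>If some \<open>e\<close> qualifies, \<open>E - Y\<close> is a 2-forest plus an edge
  inside its far component, so its only cycle avoids the component of \<open>r\<close>. Every edge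
  \<open>f\<close> of the cycle is then inner as well, and \<open>insert f Y\<close> is a tree
  exactly if \<open>f\<close> joins the two components of \<open>Y\<close>. The sum thus counts the
  edges in which a cycle crosses a cut.\<close>

lemma inner_fibre:
  assumes "Y \<subseteq> E"
  shows "(\<Sum>e\<in>E - Y. of_bool (insert e Y \<in> splits \<and> e \<in> inner (insert e Y)) :: bit) = 0"
proof (cases "\<exists>e\<in>E - Y. insert e Y \<in> splits \<and> e \<in> inner (insert e Y)")
  case True
  then obtain e where e: "e \<in> E - Y" "insert e Y \<in> splits" "e \<in> inner (insert e Y)" by blast
  obtain x y where xy: "e = {x, y}" "x \<noteq> y" "x \<in> V" "y \<in> V" using e(1) by (auto elim: edgeE)
  let ?Z = "E - Y"
  note T = splitsD[OF e(2)]
  have finY: "finite Y" using assms finE finite_subset by blast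
  have Y: "indep Y" "card Y + 2 = card V"
    using T(2,3) finY e(1) by (auto intro: indep_subset)
  have Ye: "E - insert f Y = ?Z - {f}" for f by auto
  have Ze: "?Z = insert e (?Z - {e})" using e by auto
  have "side (insert e Y) x" "side (insert e Y) y" using e(3) xy by (auto simp: inner_def)
  then have c: "conn (?Z - {e}) x y" and nr: "\<not> conn (?Z - {e}) r x" "\<not> conn (?Z - {e}) r y"
    using side_conn[OF e(2) xy(3,4)] by (auto simp: side_def Ye)
  then have nZ: "\<not> indep ?Z" using e(1) xy indep_remove_conn[of ?Z x y] by auto
  have nrZ: "\<not> conn ?Z r x"
    using nr conn_insert[of x y "?Z - {e}" r x] Ze xy by auto
  have "insert f Y \<in> splits \<and> f \<in> inner (insert f Y) \<longleftrightarrow> indep (?Z - {f}) \<and> crosses (conn Y r) f"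
    if f: "f \<in> ?Z" for f
  proof -
    obtain u v where uv: "f = {u, v}" "u \<noteq> v" "u \<in> V" "v \<in> V" using f by (auto elim: edgeE)
    have cr: "crosses (conn Y r) f \<longleftrightarrow> \<not> conn Y u v"
      using two_forest_conn[OF sub[OF assms] _ r uv(3,4)] Y uv(1) by (auto simp: two_forest_def)
    have card1: "card (insert f Y) + 1 = card V" using f finY Y by simp
    have "card (?Z - {f}) = card (?Z - {e})" using f e(1) finE by simp
    then have card2: "card (?Z - {f}) + 2 = card V" using T(5) Ye by simp
    have inn: "f \<in> inner (insert f Y)" if i: "indep (?Z - {f})"
    proof -
      have "conn ?Z x u" "conn ?Z x v"
        using cycle_conn[OF nZ, of x y u v] cycle_conn[OF nZ, of x y v u] e(1) f T(4) i
        by (auto simp: xy uv Ye insert_commute)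
      then have "\<not> conn ?Z r u" "\<not> conn ?Z r v" using nrZ by (meson conn_sym conn_trans)+
      then have "\<not> conn (?Z - {f}) r u" "\<not> conn (?Z - {f}) r v"
        by (auto dest: conn_mono[of _ _ _ ?Z])
      then show ?thesis by (auto simp: inner_def side_def Ye uv)
    qed
    have "insert f Y \<in> splits \<longleftrightarrow> indep (?Z - {f}) \<and> \<not> conn Y u v"
      using indep_insert[of u v Y] f uv Y assms card1 card2
      by (auto simp: splits_def tree_def two_forest_def Ye)
    with cr inn show ?thesis by blast
  qed
  then have "(\<Sum>e\<in>E - Y. of_bool (insert e Y \<in> splits \<and> e \<in> inner (insert e Y)) :: bit) =
    (\<Sum>f\<in>?Z. of_bool (indep (?Z - {f}) \<and> crosses (conn Y r) f))"
    by (intro sum.cong) auto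
  also have "\<dots> = 0" using sub nZ by (intro cycle_parity) auto
  finally show ?thesis .
qed (auto intro: sum.neutral)

lemma sum_inner: "(\<Sum>T\<in>splits. of_nat (card (inner T)) :: bit) = 0"
proof -
  have fin: "finite (inner T)" if "T \<in> splits" for T
    using splitsD(8)[OF that] by (simp add: inner_def)
  let ?Q = "\<lambda>Y e. insert e Y \<in> splits \<and> e \<in> inner (insert e Y)"
  have "(\<Sum>T\<in>splits. of_nat (card (inner T)) :: bit) = (\<Sum>T\<in>splits. \<Sum>e\<in>inner T. 1)"
    by simp
  also have "\<dots> = (\<Sum>m\<in>Sigma splits inner. 1)"
    using fin by (subst sum.Sigma) (auto simp: fin_splits)
  also have "\<dots> = (\<Sum>m\<in>{(Y, e) \<in> Sigma (Pow E) (\<lambda>Y. E - Y). ?Q Y e}. 1)"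
    by (rule sum.reindex_bij_witness[of _ "\<lambda>(Y, e). (insert e Y, e)" "\<lambda>(T, e). (T - {e}, e)"])
      (use splitsD(1) in \<open>fastforce simp: inner_def insert_absorb\<close>)+
  also have "\<dots> = (\<Sum>m\<in>Sigma (Pow E) (\<lambda>Y. E - Y). of_bool (case m of (Y, e) \<Rightarrow> ?Q Y e))"
    by (rule sum.mono_neutral_cong_left) (auto simp: finE)
  also have "\<dots> = (\<Sum>Y\<in>Pow E. \<Sum>e\<in>E - Y. of_bool (?Q Y e))"
    by (subst sum.Sigma) (auto simp: finE intro!: sum.cong)
  also have "\<dots> = 0"
    using inner_fibre by (intro sum.neutral) auto
  finally show ?thesis .
qed

text \<open>Label the three components of \<open>E - U\<close> by vectors of F_2^2. Two cycle edges
  of \<open>U\<close> complete \<open>E - U\<close> to a tree iff their label differences are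
  linearly independent, which is a determinant; one edge gives a 2-forest iff its label difference
  is nonzero. Both sums are thereby expressed through the coordinates of the differences along the
  cycle of \<open>U\<close>.\<close>

lemma cut_pairs_fibre:
  assumes "U \<subseteq> E"
  shows "(\<Sum>X | X \<subseteq> U \<and> card X = 2. of_bool (E - U \<union> X \<in> splits \<and> X \<subseteq> cut (E - U \<union> X)) :: bit) =
    (\<Sum>g\<in>U. of_bool (U - {g} \<in> splits))"
proof -
  let ?R = "E - U"
  have finU: "finite U" using assms finE finite_subset by blast
  have E_rem: "E - (U - {g}) = insert g ?R" if "g \<in> U" for g using that assms by auto
  have E_union: "E - (?R \<union> X) = U - X" if "X \<subseteq> U" for X using that assms by auto
  show ?thesis
  proof (cases "indep ?R \<and> card ?R + 3 = card V \<and> card U = card V")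
    \<comment> \<open>If a size is wrong or \<open>E - U\<close> contains a cycle, neither side has
      a nonzero term.\<close>
    case False
    have "U - {g} \<notin> splits" if "g \<in> U" for g
    proof
      assume T: "U - {g} \<in> splits"
      note T = splitsD[OF this]
      have "indep ?R" using T(4) unfolding E_rem[OF that] by (rule indep_subset) auto
      moreover have "card ?R + 3 = card V" using T(5) that finE unfolding E_rem[OF that] by simp
      moreover have "card U = card V" using T(3) card_Suc_Diff1[OF finU that] by simp
      ultimately show False using False by blast
    qed
    moreover have "\<not> (?R \<union> X \<in> splits)" if X: "X \<subseteq> U" "card X = 2" for X
    proof
      assume T: "?R \<union> X \<in> splits"
      note T = splitsD[OF this]
      have finX: "finite X" using X finU finite_subset by blast
      have "indep ?R" using T(2) by (rule indep_subset) auto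
      moreover have "card (?R \<union> X) = card ?R + card X"
        using X finE finX by (intro card_Un_disjoint) auto
      then have "card ?R + 3 = card V" using T(3) X by simp
      moreover have "card (U - X) + card X = card U"
        using X finU finX by (metis card_Diff_subset card_mono le_add_diff_inverse2)
      then have "card U = card V" using T(5) X E_union by simp
      ultimately show False using False by blast
    qed
    ultimately show ?thesis by (simp add: sum.neutral)
  next
    case True
    then have R: "indep ?R" "card ?R + 3 = card V" "card U = card V" by auto
    \<comment> \<open>\<open>U\<close> has as many edges as there are vertices, one too many for a
      forest.\<close>
    have "\<not> card U + card {r} \<le> card V" using R by simp
    then have nU: "\<not> indep U"
      using rank_le[OF sub[OF assms], of "{r}"] r by (auto simp: separated_def)
    obtain S where S: "S \<subseteq> V" "separated ?R S" "\<forall>x\<in>V. \<exists>s\<in>S. conn ?R x s"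
      using separated_extend[OF finV, of "{}" ?R] by (auto simp: separated_def)
    then have "card ?R + card S = card V" using sub R by (intro rank_spanning) auto
    then have "card S = 3" using R by simp
    then obtain r1 r2 r3 where S3: "S = {r1, r2, r3}" "r1 \<noteq> r2" "r2 \<noteq> r3" "r1 \<noteq> r3"
      by (auto simp: card_3_iff)
    \<comment> \<open>The pair \<open>(k1, k2)\<close> labels the three components by (1,0), (0,1)
      and (0,0); the third indicator would be redundant.\<close>
    define k1 k2 where "k1 = conn ?R r1" and "k2 = conn ?R r2"
    have uniq: "s = t" if "s \<in> S" "t \<in> S" "conn ?R s z" "conn ?R t z" for s t z
    proof -
      have "conn ?R s t" using that(3) conn_sym[OF that(4)] by (rule conn_trans)
      then show ?thesis using S(2) that(1,2) by (auto simp: separated_def)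
    qed
    have rS: "r1 \<in> S" "r2 \<in> S" using S3 by auto
    have k12: "\<not> (k1 x \<and> k2 x)" for x
      using uniq[of r1 r2 x] S3 by (auto simp: k1_def k2_def)
    have k: "conn ?R x y \<longleftrightarrow> k1 x = k1 y \<and> k2 x = k2 y" if xyV: "x \<in> V" "y \<in> V" for x y
    proof
      assume "conn ?R x y"
      then show "k1 x = k1 y \<and> k2 x = k2 y"
        unfolding k1_def k2_def using conn_cong[of ?R x y] by blast
    next
      assume a: "k1 x = k1 y \<and> k2 x = k2 y"
      obtain s t where "s \<in> S" "conn ?R x s" "t \<in> S" "conn ?R y t" using S(3) xyV by blast
      then have st: "s \<in> S" "conn ?R s x" "t \<in> S" "conn ?R t y" by (auto dest: conn_sym)
      have "s = r1 \<longleftrightarrow> k1 x" "s = r2 \<longleftrightarrow> k2 x" "t = r1 \<longleftrightarrow> k1 y" "t = r2 \<longleftrightarrow> k2 y"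
        unfolding k1_def k2_def using st rS uniq by blast+
      then have "s = t" using a st(1,3) S3(1) by auto
      then show "conn ?R x y" using st by (meson conn_sym conn_trans)
    qed
    \<comment> \<open>\<open>?a g\<close> and \<open>?b g\<close> are the coordinates of the label
      difference across \<open>g\<close>, set to 0 unless \<open>U - {g}\<close> is a
      forest.\<close>
    let ?a = "\<lambda>g. of_bool (indep (U - {g}) \<and> crosses k1 g) :: bit"
    let ?b = "\<lambda>g. of_bool (indep (U - {g}) \<and> crosses k2 g) :: bit"
    have a0: "sum ?a U = 0" and b0: "sum ?b U = 0"
      using cycle_parity[OF sub[OF assms] nU] by blast+
    have one: "of_bool (U - {g} \<in> splits) = ?a g + ?b g + ?a g * ?b g" if g: "g \<in> U" for g
    proof -
      obtain x y where xy: "g = {x, y}" "x \<in> V" "y \<in> V" using g assms by (meson edgeE subsetD)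
      have "card (U - {g}) + 1 = card V" using g finU R(3)
        by (metis Suc_eq_plus1 card_Suc_Diff1)
      moreover have "card (insert g ?R) + 2 = card V" using g finE R(2) by simp
      moreover have "indep (insert g ?R) \<longleftrightarrow> crosses k1 g \<or> crosses k2 g"
        using indep_insert[of x y ?R] R(1) g k xy by auto
      ultimately have "U - {g} \<in> splits \<longleftrightarrow> indep (U - {g}) \<and> (crosses k1 g \<or> crosses k2 g)"
        using assms by (auto simp: splits_def tree_def two_forest_def E_rem[OF g])
      then show ?thesis by auto
    qed
    have two: "of_bool (?R \<union> {e, f} \<in> splits \<and> {e, f} \<subseteq> cut (?R \<union> {e, f})) = ?a e * ?b f + ?a f * ?b e"
      if ef: "e \<in> U" "f \<in> U" "e \<noteq> f" for e f
    proof -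
      obtain x y where xy: "e = {x, y}" "x \<in> V" "y \<in> V" using ef assms by (meson edgeE subsetD)
      obtain u v where uv: "f = {u, v}" "u \<in> V" "v \<in> V" using ef assms by (meson edgeE subsetD)
      let ?T = "?R \<union> {e, f}"
      have ET: "E - ?T = U - {e, f}" using ef by (intro E_union) auto
      have Ue: "insert f (U - {e, f}) = U - {e}" and Uf: "insert e (U - {e, f}) = U - {f}"
        using ef by auto
      have c1: "card ?T + 1 = card V" using ef R(2) finE by simp
      have c2: "card (U - {e, f}) + 2 = card V"
      proof -
        have "card {e, f} \<le> card U" using ef finU by (intro card_mono) auto
        then show ?thesis using card_Diff_subset[of "{e, f}" U] ef R(3) by simp
      qed
      \<comment> \<open>Inequality of the two truth values is addition in F_2: the right side is the
        determinant of the label differences of \<open>e\<close> and \<open>f\<close>.\<close>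
      have iT: "indep ?T \<longleftrightarrow> (k1 x \<noteq> k1 y \<and> k2 u \<noteq> k2 v) \<noteq> (k1 u \<noteq> k1 v \<and> k2 x \<noteq> k2 y)"
      proof -
        have "?T = insert f (insert e ?R)" by auto
        then have "indep ?T \<longleftrightarrow> \<not> conn ?R x y \<and> \<not> conn (insert e ?R) u v"
          using indep_insert[of u v "insert e ?R"] indep_insert[of x y ?R] ef R(1) uv(1) xy(1) by auto
        also have "\<dots> \<longleftrightarrow> (k1 x \<noteq> k1 y \<and> k2 u \<noteq> k2 v) \<noteq> (k1 u \<noteq> k1 v \<and> k2 x \<noteq> k2 y)"
          using k12[of x] k12[of y] k12[of u] k12[of v]
          unfolding xy(1) conn_insert k[OF xy(2,3)] k[OF uv(2,3)] k[OF uv(2) xy(2)] k[OF xy(3) uv(3)] k[OF uv(2) xy(3)] k[OF xy(2) uv(3)]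
          by argo
        finally show ?thesis .
      qed
      have "?T \<in> splits \<and> {e, f} \<subseteq> cut ?T \<longleftrightarrow> indep (U - {e}) \<and> indep (U - {f}) \<and> indep ?T"
      proof
        assume l: "?T \<in> splits \<and> {e, f} \<subseteq> cut ?T"
        then have "insert f (E - ?T) \<in> splits" "insert e (E - ?T) \<in> splits" using swap(1) by blast+
        then show "indep (U - {e}) \<and> indep (U - {f}) \<and> indep ?T"
          using l splitsD(2) unfolding ET Ue Uf by blast
      next
        assume rhs: "indep (U - {e}) \<and> indep (U - {f}) \<and> indep ?T"
        have "indep (U - {e, f})" by (rule indep_subset[of "U - {e}"]) (use rhs in auto)
        moreover have "?T \<subseteq> E" using ef assms by auto
        ultimately have s: "?T \<in> splits"
          unfolding splits_def tree_def two_forest_def mem_Collect_eq ET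
          using rhs c1 c2 by blast
        have "\<not> conn (U - {e, f}) x y" "\<not> conn (U - {e, f}) u v"
          using rhs ef indep_remove_conn[of "U - {f}" x y, folded xy(1)]
            indep_remove_conn[of "U - {e}" u v, folded uv(1)]
          by (simp_all add: insert_commute flip: Diff_insert)
        then have "side ?T x \<noteq> side ?T y" "side ?T u \<noteq> side ?T v"
          using side_conn[OF s xy(2,3)] side_conn[OF s uv(2,3)] unfolding ET by blast+
        then have "{e, f} \<subseteq> cut ?T"
          using ef assms by (auto simp: cut_def xy(1) uv(1))
        with s show "?T \<in> splits \<and> {e, f} \<subseteq> cut ?T" by blast
      qed
      then show ?thesis unfolding iT using xy(1) uv(1) by auto
    qed
    have "(\<Sum>X | X \<subseteq> U \<and> card X = 2. of_bool (?R \<union> X \<in> splits \<and> X \<subseteq> cut (?R \<union> X)) :: bit) =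
        sum ?a U * sum ?b U + (\<Sum>e\<in>U. ?a e * ?b e)"
      using finU two by (rule sum_pairs_bit)
    \<comment> \<open>The sums of \<open>?a\<close> and \<open>?b\<close> vanish by cycle parity, so
      the product may be dropped and both sums added; what arises is the "or" of the two coordinates
      needed for \<open>one\<close>.\<close>
    also have "\<dots> = sum ?a U + sum ?b U + (\<Sum>e\<in>U. ?a e * ?b e)"
      by (simp only: a0 b0) simp
    also have "\<dots> = (\<Sum>g\<in>U. of_bool (U - {g} \<in> splits))"
      using one by (simp add: sum.distrib)
    finally show ?thesis .
  qed
qed

text \<open>The binomial counts pairs of cut edges. For fixed \<open>U\<close> they may be replaced
  by edges \<open>g\<close> of \<open>U\<close> with \<open>U - {g}\<close> a splitting, that is, by
  splittings T together with an edge \<open>g\<close> of \<open>E - T\<close>; there are |V| - 2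
  such edges, an odd number.\<close>

lemma sum_cut_choose_2:
  "(\<Sum>T\<in>splits. of_nat (card (cut T) choose 2) :: bit) = of_nat (card splits)"
proof -
  let ?P = "\<lambda>T. {X. X \<subseteq> cut T \<and> card X = 2}"
  let ?Q = "\<lambda>U X. E - U \<union> X \<in> splits \<and> X \<subseteq> cut (E - U \<union> X)"
  have finP: "finite (?P T)" for T by (rule finite_subset[of _ "Pow (cut T)"]) auto
  have finU: "finite {X. X \<subseteq> U \<and> card X = 2}" if "U \<subseteq> E" for U
    by (rule finite_subset[of _ "Pow U"]) (use that finE finite_subset in auto)
  have "(\<Sum>T\<in>splits. of_nat (card (cut T) choose 2) :: bit) = (\<Sum>T\<in>splits. \<Sum>X\<in>?P T. 1)"
    by (simp add: n_subsets)
  also have "\<dots> = (\<Sum>m\<in>Sigma splits ?P. 1)"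
    using finP by (subst sum.Sigma) (auto simp: fin_splits)
  also have "\<dots> = (\<Sum>m\<in>{(U, X) \<in> Sigma (Pow E) (\<lambda>U. {X. X \<subseteq> U \<and> card X = 2}). ?Q U X}. 1)"
  proof (rule sum.reindex_bij_witness[of _ "\<lambda>(U, X). (E - U \<union> X, X)" "\<lambda>(T, X). (E - T \<union> X, X)"])
    fix m assume "m \<in> Sigma splits ?P"
    then obtain T X where m: "m = (T, X)" "T \<in> splits" "X \<subseteq> cut T" "card X = 2" by auto
    have "X \<subseteq> T" "T \<subseteq> E" using m cut_subset splitsD(1) by blast+
    then have "E - (E - T \<union> X) \<union> X = T" by auto
    then show "(case case m of (T, X) \<Rightarrow> (E - T \<union> X, X) of (U, X) \<Rightarrow> (E - U \<union> X, X)) = m"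
      "(case m of (T, X) \<Rightarrow> (E - T \<union> X, X)) \<in>
        {(U, X) \<in> Sigma (Pow E) (\<lambda>U. {X. X \<subseteq> U \<and> card X = 2}). ?Q U X}"
      using m \<open>X \<subseteq> T\<close> \<open>T \<subseteq> E\<close> by auto
  qed auto
  also have "\<dots> = (\<Sum>m\<in>Sigma (Pow E) (\<lambda>U. {X. X \<subseteq> U \<and> card X = 2}). of_bool (case m of (U, X) \<Rightarrow> ?Q U X))"
    by (rule sum.mono_neutral_cong_left) (auto simp: finE finU)
  also have "\<dots> = (\<Sum>U\<in>Pow E. \<Sum>X | X \<subseteq> U \<and> card X = 2. of_bool (?Q U X))"
    by (subst sum.Sigma) (auto simp: finE finU intro!: sum.cong)
  also have "\<dots> = (\<Sum>U\<in>Pow E. \<Sum>g\<in>U. of_bool (U - {g} \<in> splits))"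
    using cut_pairs_fibre by (intro sum.cong) auto
  also have "\<dots> = (\<Sum>m\<in>Sigma (Pow E) (\<lambda>U. U). of_bool (fst m - {snd m} \<in> splits))"
    using finE finite_subset by (subst sum.Sigma) (auto intro!: sum.cong)
  also have "\<dots> = (\<Sum>m\<in>{m \<in> Sigma (Pow E) (\<lambda>U. U). fst m - {snd m} \<in> splits}. 1)"
    using finE finite_subset by (intro sum.mono_neutral_cong_right finite_SigmaI) auto
  also have "\<dots> = (\<Sum>m\<in>Sigma splits (\<lambda>T. E - T). 1)"
    by (rule sum.reindex_bij_witness[of _ "\<lambda>(T, g). (insert g T, g)" "\<lambda>(U, g). (U - {g}, g)"])
      (auto dest: splitsD(1))
  also have "\<dots> = (\<Sum>T\<in>splits. \<Sum>g\<in>E - T. 1)"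
    using finE by (subst sum.Sigma) (auto simp: fin_splits)
  also have "\<dots> = (\<Sum>T\<in>splits. 1)"
  proof (rule sum.cong[OF refl])
    fix T assume "T \<in> splits"
    then have "odd (card (E - T))" using splitsD(5) odd_V by (metis even_add even_numeral)
    then show "(\<Sum>g\<in>E - T. 1) = (1::bit)" by (simp add: of_nat_bit)
  qed
  finally show ?thesis by simp
qed

end

section \<open>Counting modulo 2 and the comparison of two 3-sets\<close>

lemma choose_2_add: "(m + n) choose 2 = (m choose 2) + (n choose 2) + m * (n::nat)"
proof (induction m)
  case (Suc m)
  have "Suc k choose 2 = (k choose 2) + k" for k by (simp add: numeral_2_eq_2)
  with Suc show ?case by simp
qed simp

text \<open>\<open>(4 * p) choose 2 = 2 * p * (4 * p - 1)\<close> is even. Expanding it along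
  \<open>a + 2 * e + c\<close> modulo 2, \<open>2 * e choose 2\<close> contributes \<open>e\<close>,
  and the mixed terms contribute \<open>a * c\<close>, which has the parity of \<open>a\<close>
  because \<open>a\<close> and \<open>c\<close> have the same parity.\<close>

lemma choose_2_cut:
  assumes "4 * p = a + 2 * e + (c::nat)"
  shows "(of_nat (c choose 2) :: bit) = of_nat (a choose 2) + of_nat a + of_nat e"
proof -
  have C: "(2 * k) choose 2 = k * (2 * k - 1)" for k :: nat by (simp add: choose_two)
  have "even ((4 * p) choose 2)" using C[of "2 * p"] by simp
  then have "even ((a + 2 * e + c) choose 2)" using assms by simp
  moreover have "(a + 2 * e + c) choose 2 =
      (a choose 2) + e * (2 * e - 1) + a * (2 * e) + (c choose 2) + (a + 2 * e) * c"
    by (simp add: choose_2_add C)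
  moreover have "even (e * (2 * e - 1)) \<longleftrightarrow> even e" by (cases e) auto
  moreover have "even (a + 2 * e + c)" using assms by (metis dvd_triv_left even_mult_iff even_numeral)
  ultimately show ?thesis by (auto simp: of_nat_bit)
qed

text \<open>For k = 0, 1, 2, 3 the value (k choose 2) + k is 0, 1, 3, 6: odd exactly if
  \<open>N\<close> has elements on both sides.\<close>

lemma crosses_card_3:
  assumes "card N = 3"
  shows "(of_bool (crosses s N) :: bit) = of_nat (card {x\<in>N. s x} choose 2) + of_nat (card {x\<in>N. s x})"
proof -
  obtain a b c where N: "N = {a, b, c}" "a \<noteq> b" "b \<noteq> c" "a \<noteq> c" using assms by (auto simp: card_3_iff)
  have "{x\<in>N. s x} = (if s a then {a} else {}) \<union> (if s b then {b} else {}) \<union> (if s c then {c} else {})"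
    using N by auto
  then have "card {x\<in>N. s x} = of_bool (s a) + of_bool (s b) + of_bool (s c)"
    using N by simp
  moreover have "crosses s N \<longleftrightarrow> \<not> (s a = s b \<and> s b = s c)" unfolding N(1) crosses_def by auto
  ultimately show ?thesis by (cases "s a"; cases "s b"; cases "s c") (simp_all add: of_nat_bit choose_two)
qed

lemma sum_degree:
  assumes "simple_graph V E" "P \<subseteq> V"
  shows "(\<Sum>x\<in>P. degree E x) = 2 * card {e\<in>E. e \<subseteq> P} + card {e\<in>E. crosses (\<lambda>x. x \<in> P) e}"
proof -
  note fin = simple_graph_finite[OF assms(1)]
  have finP: "finite P" using assms fin finite_subset by blast
  have "(\<Sum>x\<in>P. degree E x) = (\<Sum>x\<in>P. \<Sum>e\<in>E. of_bool (x \<in> e))"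
    by (rule sum.cong[OF refl]) (simp add: degree_def sum_of_bool_eq fin Int_def)
  also have "\<dots> = (\<Sum>e\<in>E. \<Sum>x\<in>P. of_bool (x \<in> e))" by (rule sum.swap)
  also have "\<dots> = (\<Sum>e\<in>E. 2 * of_bool (e \<subseteq> P) + of_bool (crosses (\<lambda>x. x \<in> P) e) :: nat)"
  proof (rule sum.cong[OF refl])
    fix e assume "e \<in> E"
    with assms(1) obtain x y where e: "e = {x, y}" "x \<noteq> y" by (rule simple_graph_edgeE)
    have "(\<Sum>z\<in>P. of_bool (z \<in> e)) = card (P \<inter> e)" using finP by (simp add: sum_of_bool_eq Int_def)
    also have "P \<inter> e = (if x \<in> P then {x} else {}) \<union> (if y \<in> P then {y} else {})" using e by auto
    also have "card \<dots> = 2 * of_bool (e \<subseteq> P) + of_bool (crosses (\<lambda>x. x \<in> P) e)"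
      using e by auto
    finally show "(\<Sum>z\<in>P. of_bool (z \<in> e)) = (2 * of_bool (e \<subseteq> P) + of_bool (crosses (\<lambda>x. x \<in> P) e) :: nat)" .
  qed
  also have "\<dots> = 2 * card {e\<in>E. e \<subseteq> P} + card {e\<in>E. crosses (\<lambda>x. x \<in> P) e}"
    using fin by (simp add: sum.distrib sum_of_bool_eq Int_def flip: sum_distrib_left)
  finally show ?thesis .
qed

context tree_splits
begin

definition far :: "'a set set \<Rightarrow> 'a set" where
  "far T = {x\<in>V. side T x}"

text \<open>The edges inside the far side that are not in \<open>T\<close> form a spanning tree of
  it, so they number one less than its vertices.\<close>

lemma inner_card:
  assumes "T \<in> splits"
  shows "card {e\<in>E. e \<subseteq> far T} + 1 = card (inner T) + card (far T)"
proof -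
  note T = splitsD[OF assms]
  let ?F = "{e\<in>E - T. e \<subseteq> far T}"
  have eV: "e \<subseteq> V" if "e \<in> E" for e using that graph by (auto simp: simple_graph_def)
  \<comment> \<open>An empty far side would make the 2-forest connected, giving it one edge too
    many; a root \<open>p\<close> for the tree on the far side therefore exists.\<close>
  have "\<exists>p\<in>V. side T p"
  proof (rule ccontr)
    assume "\<not> (\<exists>p\<in>V. side T p)"
    then have "\<forall>x\<in>V. \<exists>s\<in>{r}. conn (E - T) x s" by (auto simp: side_def intro: conn_sym)
    then have "card (E - T) + card {r} = card V"
      using r T(4) by (intro rank_spanning sub) (auto simp: separated_def)
    then show False using T(5) by simp
  qed
  then obtain p where p: "p \<in> V" "side T p" by blast
  have c: "conn ?F p x \<and> x \<in> far T" if "conn (E - T) p x" for x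
    using that
  proof (induction rule: conn_induct)
    case (step y z)
    then have "conn (E - T) p z" by (meson conn_step)
    moreover have "z \<in> V" using step.hyps(2) eV by blast
    ultimately have "z \<in> far T" using side_conn[OF assms p(1)] p(2) by (auto simp: far_def)
    then have "{y, z} \<in> ?F" using step by auto
    then show ?case using step.IH \<open>z \<in> far T\<close> conn_step[of ?F p y z] by simp
  qed (use p in \<open>auto simp: far_def\<close>)
  have "card ?F + card {p} = card (far T)"
  proof (rule rank_spanning)
    show "simple_graph (far T) ?F"
      using graph finV by (auto simp: simple_graph_def far_def)
    show "indep ?F" using T(4) by (rule indep_subset) auto
    show "\<forall>x\<in>far T. \<exists>s\<in>{p}. conn ?F x s"
      using c side_conn[OF assms p(1)] p(2) by (auto simp: far_def intro: conn_sym)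
  qed (use p in \<open>auto simp: far_def separated_def\<close>)
  moreover have "{e\<in>E. e \<subseteq> far T} = inner T \<union> ?F"
    using T(1) eV by (auto simp: inner_def far_def)
  moreover have "card (inner T \<union> ?F) = card (inner T) + card ?F"
    using T(8) finE by (intro card_Un_disjoint) (auto simp: inner_def)
  ultimately show ?thesis by simp
qed

lemma sum_card_side:
  assumes "S \<subseteq> V"
  shows "(\<Sum>T\<in>splits. of_nat (card {x\<in>S. side T x}) :: bit) = 0"
    and "(\<Sum>T\<in>splits. of_nat (card (cut T)) * of_nat (card {x\<in>S. side T x}) :: bit) = 0"
proof -
  have "finite S" using assms finV finite_subset by blast
  then have c: "of_nat (card {x\<in>S. side T x}) = (\<Sum>x\<in>S. of_bool (side T x) :: bit)" for T
    by (simp add: sum_of_bool_eq Int_def)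
  show "(\<Sum>T\<in>splits. of_nat (card {x\<in>S. side T x}) :: bit) = 0"
    unfolding c using sum_side assms by (subst sum.swap) (auto intro: sum.neutral)
  show "(\<Sum>T\<in>splits. of_nat (card (cut T)) * of_nat (card {x\<in>S. side T x}) :: bit) = 0"
    unfolding c sum_distrib_left using sum_cut_side assms by (subst sum.swap) (auto intro: sum.neutral)
qed

text \<open>\<open>deg\<close> describes a 4-regular graph from which two adjacent vertices were
  deleted: each vertex lacks one degree for each deleted neighbour, and \<open>N1\<close>,
  \<open>N2\<close> are the remaining neighbourhoods.\<close>

lemma separating_splits_parity:
  assumes N: "N1 \<subseteq> V" "card N1 = 3" "N2 \<subseteq> V" "card N2 = 3"
    and deg: "\<And>x. x \<in> V \<Longrightarrow> degree E x + of_bool (x \<in> N1) + of_bool (x \<in> N2) = 4"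
  shows "(\<Sum>T\<in>splits. of_bool (crosses (side T) N1) :: bit) = (\<Sum>T\<in>splits. of_bool (crosses (side T) N2))"
proof -
  define a b p e where "a = (\<lambda>T. card {x\<in>N1. side T x})" and "b = (\<lambda>T. card {x\<in>N2. side T x})"
    and "p = (\<lambda>T. card (far T))" and "e = (\<lambda>T. card {e\<in>E. e \<subseteq> far T})"
  have count: "4 * p T = (a T + b T) + 2 * e T + card (cut T)" for T
  proof -
    have finP: "finite (far T)" using finV by (simp add: far_def)
    have "crosses (\<lambda>x. x \<in> far T) f \<longleftrightarrow> crosses (side T) f" if f: "f \<in> E" for f
    proof -
      obtain x y where "f = {x, y}" "x \<in> V" "y \<in> V" using f by (rule edgeE)
      then show ?thesis by (simp add: far_def)
    qed
    then have cut: "{f\<in>E. crosses (\<lambda>x. x \<in> far T) f} = cut T" by (auto simp: cut_def)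
    have "4 * p T = (\<Sum>x\<in>far T. degree E x + of_bool (x \<in> N1) + of_bool (x \<in> N2))"
      using deg by (simp add: p_def far_def)
    also have "\<dots> = (\<Sum>x\<in>far T. degree E x) + card (far T \<inter> N1) + card (far T \<inter> N2)"
      using finP by (simp add: sum.distrib sum_of_bool_eq Int_def)
    also have "(\<Sum>x\<in>far T. degree E x) = 2 * e T + card (cut T)"
      unfolding e_def cut[symmetric] by (rule sum_degree[OF graph]) (auto simp: far_def)
    also have "far T \<inter> N1 = {x\<in>N1. side T x}" using N by (auto simp: far_def)
    also have "far T \<inter> N2 = {x\<in>N2. side T x}" using N by (auto simp: far_def)
    finally show ?thesis by (simp add: a_def b_def)
  qed
  have sums: "(\<Sum>T\<in>splits. of_nat (a T) :: bit) = 0" "(\<Sum>T\<in>splits. of_nat (b T) :: bit) = 0"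
    "(\<Sum>T\<in>splits. of_nat (p T) :: bit) = 0" "(\<Sum>T\<in>splits. of_nat (card (cut T)) * of_nat (a T) :: bit) = 0"
    using sum_card_side[of N1] sum_card_side[of N2] sum_card_side[of V] N
    by (simp_all add: a_def b_def p_def far_def)
  have cut_ab: "of_nat (card (cut T)) = (of_nat (a T) + of_nat (b T) :: bit)" for T
  proof -
    have "even (4 * p T)" by simp
    then have "even (card (cut T)) \<longleftrightarrow> even (a T + b T)" unfolding count by auto
    then show ?thesis by (auto simp: of_nat_bit)
  qed
  \<comment> \<open>Since squares equal their bases in F_2, multiplying \<open>cut_ab\<close> by
    \<open>a T\<close> isolates the mixed term.\<close>
  have "of_nat (card (cut T)) * of_nat (a T) = (of_nat (a T) + of_nat (a T * b T) :: bit)" for T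
    unfolding cut_ab by (simp add: of_nat_bit)
  then have ab: "(\<Sum>T\<in>splits. of_nat (a T * b T) :: bit) = 0"
    using sums(1,4) by (simp add: sum.distrib)
  have e: "of_nat (e T) = (of_nat (card (inner T)) + of_nat (p T) + 1 :: bit)" if "T \<in> splits" for T
  proof -
    have "of_nat (e T) + 1 = (of_nat (card (inner T)) + of_nat (p T) :: bit)"
      using arg_cong[OF inner_card[OF that], of "of_nat :: nat \<Rightarrow> bit"] by (simp add: e_def p_def add.commute)
    then show ?thesis
      by (cases "of_nat (e T) :: bit"; cases "of_nat (card (inner T)) :: bit"; cases "of_nat (p T) :: bit") simp_all
  qed
  have "(of_nat (card splits) :: bit) = (\<Sum>T\<in>splits. of_nat (card (cut T) choose 2))"
    by (simp add: sum_cut_choose_2)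
  also have "\<dots> = (\<Sum>T\<in>splits. of_nat (a T + b T choose 2) + of_nat (a T) + of_nat (b T) +
      of_nat (card (inner T)) + of_nat (p T) + 1)"
    using choose_2_cut[OF count] e by (intro sum.cong) (auto simp: ac_simps)
  also have "\<dots> = (\<Sum>T\<in>splits. of_nat (a T + b T choose 2)) + of_nat (card splits)"
    using sums sum_inner by (simp add: sum.distrib)
  \<comment> \<open>The number of splittings stands on both sides and cancels: on the left it comes
    from the odd |F|, on the right from the constant 1 in \<open>e\<close>.\<close>
  finally have "(\<Sum>T\<in>splits. of_nat (a T + b T choose 2) :: bit) = 0"
    by (cases "of_nat (card splits) :: bit"; cases "\<Sum>T\<in>splits. of_nat (a T + b T choose 2) :: bit") simp_all
  then have "(\<Sum>T\<in>splits. of_nat (a T choose 2) :: bit) + (\<Sum>T\<in>splits. of_nat (b T choose 2)) = 0"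
    unfolding choose_2_add of_nat_add sum.distrib ab by simp
  then have "(\<Sum>T\<in>splits. of_nat (a T choose 2) + of_nat (a T) :: bit) =
      (\<Sum>T\<in>splits. of_nat (b T choose 2) + of_nat (b T))"
    using sums(1,2) by (simp add: sum.distrib bit_add_eq_0_iff)
  then show ?thesis using N by (simp add: crosses_card_3 a_def b_def)
qed

end

section \<open>Weighted forests and harmonic functions\<close>

lemma simple_graph_neighbour: "simple_graph V E \<Longrightarrow> {x, z} \<in> E \<Longrightarrow> z \<in> V"
  unfolding simple_graph_def by blast

lemma finite_neighbours: "simple_graph V E \<Longrightarrow> finite {z. {x, z} \<in> E}"
  by (rule finite_subset[of _ V]) (auto simp: simple_graph_neighbour simple_graph_finite)

lemma path_current:
  assumes "simple_graph V A" "indep A" "conn A y j"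
  shows "(\<Sum>z | {x, z} \<in> A. of_bool (conn (A - {{x, z}}) y x) - of_bool (conn (A - {{x, z}}) j x)) =
    (of_bool (x = y) - of_bool (x = j) :: real)"
  using assms(3)
proof (induction rule: conn_induct)
  case (step j k)
  let ?Z = "{z. {x, z} \<in> A}"
  let ?t = "\<lambda>j z. of_bool (conn (A - {{x, z}}) y x) - of_bool (conn (A - {{x, z}}) j x) :: real"
  have finZ: "finite ?Z"
    using assms(1) by (rule finite_neighbours)
  have jk: "j \<noteq> k" using assms(1) step.hyps(2) by (auto simp: simple_graph_def)
  have nc: "\<not> conn (A - {{j, k}}) j k"
    using assms(2) step.hyps(2) by (rule indep_remove_conn)
  have eq: "?t k z = ?t j z" if "z \<in> ?Z" "{x, z} \<noteq> {j, k}" for z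
  proof -
    have "conn (A - {{x, z}}) j k" using that step.hyps by (intro conn_edge) auto
    then have "conn (A - {{x, z}}) j x \<longleftrightarrow> conn (A - {{x, z}}) k x"
      using conn_cong[of "A - {{x, z}}" j k x] conn_sym by metis
    then show ?thesis by simp
  qed
  \<comment> \<open>Moving the sink across the edge \<open>{j, k}\<close> changes the flow on that
    edge only, so only \<open>x = j\<close> and \<open>x = k\<close> notice it.\<close>
  have "(\<Sum>z\<in>?Z. ?t k z - ?t j z) = of_bool (x = j) - of_bool (x = k)"
  proof -
    consider "x = j" | "x = k" | "x \<noteq> j" "x \<noteq> k" by blast
    then show ?thesis
    proof cases
      case 1
      have "(\<Sum>z\<in>?Z. ?t k z - ?t j z) = (\<Sum>z\<in>?Z. if z = k then 1 else 0)"
        using eq nc 1 conn_sym[of "A - {{j, k}}" k j] by (intro sum.cong) (auto simp: doubleton_eq_iff)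
      then show ?thesis using 1 jk step.hyps(2) finZ by simp
    next
      case 2
      have "(\<Sum>z\<in>?Z. ?t k z - ?t j z) = (\<Sum>z\<in>?Z. if z = j then - 1 else 0)"
        using eq nc 2 by (intro sum.cong) (auto simp: doubleton_eq_iff insert_commute)
      then show ?thesis using 2 jk step.hyps(2) finZ by (simp add: insert_commute)
    next
      case 3
      have "(\<Sum>z\<in>?Z. ?t k z - ?t j z) = (\<Sum>z\<in>?Z. 0)"
        using eq 3 by (intro sum.cong) (auto simp: doubleton_eq_iff)
      then show ?thesis using 3 by simp
    qed
  qed
  then show ?case using step.IH unfolding sum_subtractf by linarith
qed simp

text \<open>For \<open>S\<close> contained in \<open>V\<close>, the rank formula makes these the
  spanning forests in which every component contains exactly one element of
  \<open>S\<close>.\<close>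

definition rooted :: "'a set \<Rightarrow> 'a set set \<Rightarrow> 'a set \<Rightarrow> 'a set set set" where
  "rooted V E S = {A. A \<subseteq> E \<and> indep A \<and> card A + card S = card V \<and> separated A S}"

lemma finite_rooted: "simple_graph V E \<Longrightarrow> finite (rooted V E S)"
  by (rule finite_subset[of _ "Pow E"]) (auto simp: rooted_def simple_graph_finite)

text \<open>The product runs over the edges of the forest, unlike in the Kirchhoff polynomial,
  because this is the convention in which the weights act as conductances.\<close>

definition forest_weight :: "('a set \<Rightarrow> real) \<Rightarrow> 'a set set set \<Rightarrow> real" where
  "forest_weight w \<A> = (\<Sum>A\<in>\<A>. \<Prod>e\<in>A. w e)"

text \<open>For \<open>S = {c}\<close> these are the 2-forests with \<open>x\<close> and
  \<open>y\<close> in one component and \<open>c\<close> in the other; their generating functions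
  are the spanning forest polynomials f1, f2, f3.\<close>

definition joined :: "'a set \<Rightarrow> 'a set set \<Rightarrow> 'a set \<Rightarrow> 'a \<Rightarrow> 'a \<Rightarrow> 'a set set set" where
  "joined V E S y x = {A \<in> rooted V E (insert y S). conn A x y}"

text \<open>The Kirchhoff current law: the weight of the forests joining \<open>x\<close> to \<open>y\<close> is, as a function
  of \<open>x\<close>, the potential for a unit source at \<open>y\<close> and the grounded set \<open>S\<close>, up to a factor.\<close>

lemma current_law:
  assumes G: "simple_graph V E" and "S \<subseteq> V" "y \<in> V - S" "x \<in> V - S"
  shows "(\<Sum>z | {x, z} \<in> E. w {x, z} *
      (forest_weight w (joined V E S y x) - forest_weight w (joined V E S y z))) =
    of_bool (x = y) * forest_weight w (rooted V E S)"
proof -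
  let ?N = "\<lambda>A. {z. {x, z} \<in> A}" and ?R = "rooted V E (insert y S)"
  let ?wt = "\<lambda>A. \<Prod>e\<in>A. w e"
  note finV = simple_graph_finite(1)[OF G] and finE = simple_graph_finite(2)[OF G]
  have finN: "finite (?N A)" if "A \<subseteq> E" for A
    using simple_graph_subset[OF G that] by (rule finite_neighbours)
  have finS: "finite S" using assms(2) finV finite_subset by blast
  have fin: "finite ?R" "finite (rooted V E S)" using G finite_rooted by blast+
  have y: "y \<notin> S" "y \<in> V" "x \<notin> S" "x \<in> V" using assms by auto
  have cardS: "card (insert y S) = card S + 1" using y(1) finS by simp
  have pot: "forest_weight w (joined V E S y u) = (\<Sum>A\<in>?R. ?wt A * of_bool (conn A u y))" for u
    unfolding forest_weight_def joined_def using fin(1)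
    by (intro sum.mono_neutral_cong_left) auto
  let ?t = "\<lambda>z A. w {x, z} * ?wt A * (of_bool (conn A x y) - of_bool (conn A z y))"
  \<comment> \<open>Only pairs in which \<open>{x, z}\<close> links the component of
    \<open>y\<close> to another one contribute; adding the edge then yields a forest rooted at
    \<open>S\<close>.\<close>
  let ?\<Theta> = "{(z, A) \<in> ?N E \<times> ?R. {x, z} \<notin> A \<and> insert {x, z} A \<in> rooted V E S}"
  have zero: "?t z A = 0" if z: "z \<in> ?N E" and A: "A \<in> ?R" and n: "\<not> ({x, z} \<notin> A \<and> insert {x, z} A \<in> rooted V E S)" for z A
  proof (rule ccontr)
    assume "?t z A \<noteq> 0"
    then have ne: "conn A x y \<noteq> conn A z y" by (cases "conn A x y"; cases "conn A z y") auto
    then have xz: "\<not> conn A x z" using conn_cong[of A x z y] conn_sym by metis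
    then have new: "{x, z} \<notin> A" using conn_edge by metis
    have A': "A \<subseteq> E" "indep A" "card A + card S + 1 = card V" "separated A (insert y S)"
      using A cardS by (auto simp: rooted_def)
    have "finite A" using A'(1) finE finite_subset by blast
    have "indep (insert {x, z} A)" using indep_insert[OF new] A'(2) xz by blast
    moreover have "card (insert {x, z} A) + card S = card V" using new \<open>finite A\<close> A'(3) by simp
    \<comment> \<open>The new edge attaches to another component that of \<open>y\<close>, which
      contains no element of \<open>S\<close>.\<close>
    moreover have "separated (insert {x, z} A) S"
      unfolding separated_def conn_insert
    proof (intro ballI impI)
      fix s t assume st: "s \<in> S" "t \<in> S"
        and c: "conn A s t \<or> conn A s x \<and> conn A z t \<or> conn A s z \<and> conn A x t"
      have no: "\<not> conn A s y" "\<not> conn A t y" "\<not> conn A y s" "\<not> conn A y t"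
        using A'(4) st y(1) unfolding separated_def by blast+
      show "s = t"
      proof (cases "conn A s t")
        case True
        then show ?thesis using A'(4) st unfolding separated_def by blast
      next
        case False
        with c ne no show ?thesis by (meson conn_sym conn_trans)
      qed
    qed
    ultimately have "insert {x, z} A \<in> rooted V E S" using A'(1) z by (auto simp: rooted_def)
    with n new show False by blast
  qed
  have "(\<Sum>z | {x, z} \<in> E. w {x, z} *
      (forest_weight w (joined V E S y x) - forest_weight w (joined V E S y z))) = (\<Sum>z\<in>?N E. \<Sum>A\<in>?R. ?t z A)"
    unfolding pot by (simp add: sum_distrib_left right_diff_distrib sum_subtractf mult.assoc)
  also have "\<dots> = (\<Sum>m\<in>?N E \<times> ?R. ?t (fst m) (snd m))"
    using finN fin by (simp add: sum.cartesian_product case_prod_unfold)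
  also have "\<dots> = (\<Sum>m\<in>?\<Theta>. ?t (fst m) (snd m))"
  proof (intro sum.mono_neutral_right ballI)
    fix m assume m: "m \<in> ?N E \<times> ?R - ?\<Theta>"
    show "?t (fst m) (snd m) = 0" by (rule zero) (use m in auto)
  qed (use finN fin in auto)
  finally have L: "(\<Sum>z | {x, z} \<in> E. w {x, z} *
      (forest_weight w (joined V E S y x) - forest_weight w (joined V E S y z))) = (\<Sum>m\<in>?\<Theta>. ?t (fst m) (snd m))" .

  \<comment> \<open>\<open>\<rho> B\<close> is the root of the component of \<open>y\<close> in
    \<open>B\<close>. Each forest \<open>B\<close> rooted at \<open>S\<close> is read as a unit flow
    from \<open>y\<close> to \<open>\<rho> B\<close>, and \<open>?u z B\<close> is its weighted flow
    from \<open>x\<close> to \<open>z\<close>.\<close>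
  define \<rho> where "\<rho> B = (SOME s. s \<in> S \<and> conn B y s)" for B
  have \<rho>: "\<rho> B \<in> S" "conn B y (\<rho> B)" if "B \<in> rooted V E S" for B
  proof -
    have B: "simple_graph V B" "indep B" "separated B S" "card B + card S = card V"
      using that simple_graph_subset[OF G] by (auto simp: rooted_def)
    have "\<exists>s\<in>S. conn B y s" by (rule rank_eq_spanning[OF B(1,2) assms(2) B(3,4) y(2)])
    then have "\<exists>s. s \<in> S \<and> conn B y s" by blast
    from someI_ex[OF this] show "\<rho> B \<in> S" "conn B y (\<rho> B)" by (auto simp: \<rho>_def)
  qed
  let ?u = "\<lambda>z B. ?wt B * (of_bool (conn (B - {{x, z}}) y x) - of_bool (conn (B - {{x, z}}) (\<rho> B) x))"
  let ?\<Phi> = "Sigma (rooted V E S) ?N"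
  let ?\<Phi>' = "{(B, z) \<in> ?\<Phi>. B - {{x, z}} \<in> ?R}"
  \<comment> \<open>If \<open>B\<close> without the edge is not in \<open>?R\<close>, then
    \<open>y\<close> and \<open>\<rho> B\<close> are still joined, so the edge is not on the path
    and carries no flow.\<close>
  have zero': "?u z B = 0" if B: "B \<in> rooted V E S" and z: "z \<in> ?N B" and n: "B - {{x, z}} \<notin> ?R" for z B
  proof -
    let ?A = "B - {{x, z}}"
    have B': "B \<subseteq> E" "indep B" "card B + card S = card V" "separated B S" using B by (auto simp: rooted_def)
    have "finite B" using B'(1) finE finite_subset by blast
    have iA: "indep ?A" using B'(2) by (rule indep_subset) auto
    have "card ?A + 1 = card B" using z \<open>finite B\<close> card_Suc_Diff1[of B "{x, z}"] by simp
    then have "\<not> separated ?A (insert y S)"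
      using n iA B' cardS by (auto simp: rooted_def)
    then obtain p q where pq: "p \<in> insert y S" "q \<in> insert y S" "conn ?A p q" "p \<noteq> q"
      unfolding separated_def by blast
    have AB: "conn B s t" if "conn ?A s t" for s t using that by (rule conn_mono) auto
    have "\<not> (p \<in> S \<and> q \<in> S)" using B'(4) pq AB unfolding separated_def by blast
    then obtain s where s: "s \<in> S" "conn ?A y s" using pq conn_sym[OF pq(3)] by auto
    have "conn B s (\<rho> B)" using conn_sym[OF AB[OF s(2)]] \<rho>(2)[OF B] by (rule conn_trans)
    then have "s = \<rho> B" using B'(4) s(1) \<rho>(1)[OF B] unfolding separated_def by blast
    then have "conn ?A y x \<longleftrightarrow> conn ?A (\<rho> B) x"
      using conn_cong[OF s(2), of x] conn_sym by metis
    then show ?thesis by simp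
  qed
  \<comment> \<open>Deleting the edge separates \<open>y\<close> from \<open>\<rho> B\<close>;
    whichever of the two stays with \<open>x\<close>, the flow term and the potential difference
    have the same sign.\<close>
  have match: "?u z B = ?t z (B - {{x, z}})"
    if B: "B \<in> rooted V E S" and z: "z \<in> ?N B" and R: "B - {{x, z}} \<in> ?R" for z B
  proof -
    let ?A = "B - {{x, z}}"
    have "finite B" "indep B" using B finE finite_subset by (auto simp: rooted_def)
    have "?wt B = w {x, z} * ?wt ?A"
      using z \<open>finite B\<close> by (simp add: prod.remove)
    moreover have xz: "\<not> conn ?A x z" using \<open>indep B\<close> z by (simp add: indep_remove_conn)
    moreover have ny: "\<not> conn ?A y (\<rho> B)"
      using R \<rho>(1)[OF B] y(1) by (auto simp: rooted_def separated_def)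
    moreover have "insert {x, z} ?A = B" using z by auto
    then have "conn ?A y x \<and> conn ?A z (\<rho> B) \<or> conn ?A y z \<and> conn ?A x (\<rho> B)"
      using \<rho>(2)[OF B] ny conn_insert[of x z ?A y "\<rho> B"] by auto
    then have "(conn ?A y x \<and> \<not> conn ?A (\<rho> B) x \<and> conn ?A x y \<and> \<not> conn ?A z y) \<or>
      (\<not> conn ?A y x \<and> conn ?A (\<rho> B) x \<and> \<not> conn ?A x y \<and> conn ?A z y)"
      using xz ny by (meson conn_sym conn_trans)
    ultimately show ?thesis by auto
  qed
  have "of_bool (x = y) * forest_weight w (rooted V E S) =
      (\<Sum>B\<in>rooted V E S. ?wt B * (of_bool (x = y) - of_bool (x = \<rho> B)))"
    unfolding forest_weight_def sum_distrib_left using \<rho>(1) y(3) by (intro sum.cong) auto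
  also have "\<dots> = (\<Sum>B\<in>rooted V E S. \<Sum>z\<in>?N B. ?u z B)"
  proof (rule sum.cong[OF refl])
    fix B assume B: "B \<in> rooted V E S"
    then have "simple_graph V B" "indep B" using simple_graph_subset[OF G] by (auto simp: rooted_def)
    from path_current[OF this \<rho>(2)[OF B], of x]
    show "?wt B * (of_bool (x = y) - of_bool (x = \<rho> B)) = (\<Sum>z\<in>?N B. ?u z B)"
      by (simp flip: sum_distrib_left)
  qed
  also have "\<dots> = (\<Sum>m\<in>?\<Phi>. ?u (snd m) (fst m))"
    using fin finN by (subst sum.Sigma) (auto simp: rooted_def case_prod_unfold)
  also have "\<dots> = (\<Sum>m\<in>?\<Phi>'. ?u (snd m) (fst m))"
  proof (intro sum.mono_neutral_right ballI)
    fix m assume m: "m \<in> ?\<Phi> - ?\<Phi>'"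
    show "?u (snd m) (fst m) = 0" by (rule zero') (use m in auto)
  next
    show "finite ?\<Phi>" using fin(2) finN by (rule finite_SigmaI) (auto simp: rooted_def)
  qed auto
  also have "\<dots> = (\<Sum>m\<in>?\<Theta>. ?t (fst m) (snd m))"
  proof (rule sum.reindex_bij_witness[of _ "\<lambda>(z, A). (insert {x, z} A, z)" "\<lambda>(B, z). (z, B - {{x, z}})"])
    fix m assume "m \<in> ?\<Phi>'"
    then obtain B z where m: "m = (B, z)" "B \<in> rooted V E S" "z \<in> ?N B" "B - {{x, z}} \<in> ?R"
      by auto
    show "?t (fst (case m of (B, z) \<Rightarrow> (z, B - {{x, z}}))) (snd (case m of (B, z) \<Rightarrow> (z, B - {{x, z}}))) =
        ?u (snd m) (fst m)"
      unfolding m(1) prod.case fst_conv snd_conv by (rule match[OF m(2-4), symmetric])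
    show "(case m of (B, z) \<Rightarrow> (z, B - {{x, z}})) \<in> ?\<Theta>"
      using m by (auto simp: insert_absorb rooted_def)
  qed (auto simp: insert_absorb rooted_def)
  finally show ?thesis using L by simp
qed

text \<open>Discrete maximum principle: at a vertex with positive maximum all summands are
  nonnegative and add up to 0, so positive weights force every neighbour to attain the maximum too.
  This spreads along a path until it meets \<open>S\<close>, where the value is 0.\<close>

lemma harmonic_le_0:
  fixes k :: "'a \<Rightarrow> real"
  assumes G: "simple_graph V E" and w: "\<And>e. e \<in> E \<Longrightarrow> w e > 0"
    and S: "\<And>x. x \<in> S \<Longrightarrow> k x = 0" "\<And>x. x \<in> V \<Longrightarrow> \<exists>s\<in>S. conn E x s"
    and harm: "\<And>x. x \<in> V - S \<Longrightarrow> (\<Sum>z | {x, z} \<in> E. w {x, z} * (k x - k z)) = 0"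
    and x: "x \<in> V"
  shows "k x \<le> 0"
proof -
  note finV = simple_graph_finite(1)[OF G]
  have "finite (k ` V)" "k ` V \<noteq> {}" using finV x by auto
  then obtain m where m: "m \<in> V" "k m = Max (k ` V)" by (metis Max_in imageE)
  then have max: "k z \<le> k m" if "z \<in> V" for z using finV that by simp
  have "k m \<le> 0"
  proof (rule ccontr)
    assume pos: "\<not> k m \<le> 0"
    obtain s where s: "s \<in> S" "conn E m s" using S(2) m(1) by blast
    have "s \<in> V \<and> k s = k m"
      using s(2)
    proof (rule conn_preserved)
      fix u v assume uv: "{u, v} \<in> E" and u: "u \<in> V \<and> k u = k m"
      have nb: "z \<in> V" if "{u, z} \<in> E" for z using G that by (rule simple_graph_neighbour)
      have finN: "finite {z. {u, z} \<in> E}" using G by (rule finite_neighbours)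
      have "u \<in> V - S" using u pos S(1) by auto
      from harm[OF this] have "\<forall>z\<in>{z. {u, z} \<in> E}. w {u, z} * (k u - k z) = 0"
        using w max nb u by (subst (asm) sum_nonneg_eq_0_iff[OF finN]) (auto simp: less_imp_le)
      then have "k u - k v = 0" using uv w[OF uv] by auto
      then show "v \<in> V \<and> k v = k m" using u nb[OF uv] by auto
    qed (use m in auto)
    then show False using pos S(1)[OF s(1)] by simp
  qed
  then show ?thesis using max[OF x] by linarith
qed

lemma harmonic_eq_0:
  fixes k :: "'a \<Rightarrow> real"
  assumes G: "simple_graph V E" and w: "\<And>e. e \<in> E \<Longrightarrow> w e > 0"
    and S: "\<And>x. x \<in> S \<Longrightarrow> k x = 0" "\<And>x. x \<in> V \<Longrightarrow> \<exists>s\<in>S. conn E x s"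
    and harm: "\<And>x. x \<in> V - S \<Longrightarrow> (\<Sum>z | {x, z} \<in> E. w {x, z} * (k x - k z)) = 0"
    and x: "x \<in> V"
  shows "k x = 0"
proof -
  have "k x \<le> 0" using G w S harm x by (rule harmonic_le_0)
  moreover have "- k x \<le> 0"
  proof (rule harmonic_le_0[OF G w, where k = "\<lambda>x. - k x"])
    fix x assume "x \<in> V - S"
    from harm[OF this] have "- (\<Sum>z | {x, z} \<in> E. w {x, z} * (k x - k z)) = 0" by simp
    then show "(\<Sum>z | {x, z} \<in> E. w {x, z} * (- k x - - k z)) = 0"
      by (simp add: algebra_simps flip: sum_negf)
  qed (use S x in auto)
  ultimately show ?thesis by simp
qed

section \<open>The quadratic identity between spanning forest polynomials\<close>

lemma rooted_singleton:
  "rooted V E {c} = {T. T \<subseteq> E \<and> tree V T}"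
  by (auto simp: rooted_def separated_def tree_def)

lemma rooted_empty:
  assumes "simple_graph V E" "V \<noteq> {}"
  shows "rooted V E {} = {}"
proof -
  obtain r where r: "r \<in> V" using assms by blast
  have "card A \<noteq> card V" if A: "A \<subseteq> E" "indep A" for A
    using rank_le[OF simple_graph_subset[OF assms(1) A(1)] A(2), of "{r}"] r by (simp add: separated_def)
  then show ?thesis by (auto simp: rooted_def)
qed

text \<open>A path from \<open>a\<close> to \<open>c\<close> leaves the component of
  \<open>a\<close> along some edge, and adding it completes the 2-forest to a tree. This settles the
  case of a graph without spanning trees.\<close>

lemma rooted_extend:
  assumes G: "simple_graph V E" and A: "A \<in> rooted V E {a, c}" and "a \<noteq> c" "conn E a c"
  shows "\<exists>T\<subseteq>E. tree V T"
proof -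
  have nc: "\<not> conn A a c" using A assms(3) by (auto simp: rooted_def separated_def)
  have "\<exists>u v. {u, v} \<in> E \<and> conn A a u \<and> \<not> conn A a v"
  proof (rule ccontr)
    assume "\<not> ?thesis"
    then have "conn A a c" using conn_preserved[OF assms(4), of "conn A a"] by auto
    with nc show False by blast
  qed
  then obtain u v where uv: "{u, v} \<in> E" "conn A a u" "\<not> conn A a v" by blast
  then have "\<not> conn A u v" by (meson conn_trans)
  moreover from this have "{u, v} \<notin> A" using conn_edge by metis
  moreover have "finite A" using A simple_graph_finite(2)[OF G] finite_subset by (auto simp: rooted_def)
  ultimately have "tree V (insert {u, v} A)"
    using A assms(3) by (simp add: rooted_def tree_def indep_insert)
  moreover have "insert {u, v} A \<subseteq> E" using A uv(1) by (simp add: rooted_def)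
  ultimately show ?thesis by blast
qed

lemma finite_joined: "simple_graph V E \<Longrightarrow> finite (joined V E S y x)"
  unfolding joined_def by (simp add: finite_rooted)

lemma joined_self: "joined V E S y y = rooted V E (insert y S)"
  by (simp add: joined_def)

lemma joined_root:
  assumes "s \<in> S" "y \<notin> S"
  shows "joined V E S y s = {}"
  using assms by (auto simp: joined_def rooted_def separated_def)

lemma joined_commute:
  assumes "x \<noteq> z" "y \<noteq> z"
  shows "joined V E {z} x y = joined V E {z} y x"
proof -
  have "joined V E {z} x y \<subseteq> joined V E {z} y x" if "x \<noteq> z" "y \<noteq> z" for x y
  proof
    fix A assume A: "A \<in> joined V E {z} x y"
    then have yx: "conn A y x" "\<not> conn A x z" "\<not> conn A z x"
      using that by (auto simp: joined_def rooted_def separated_def)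
    then have "\<not> conn A y z" "\<not> conn A z y" by (meson conn_sym conn_trans)+
    then show "A \<in> joined V E {z} y x"
      using A that conn_sym[OF yx(1)] by (auto simp: joined_def rooted_def separated_def)
  qed
  then show ?thesis using assms by blast
qed

lemma joined_split:
  assumes G: "simple_graph V E" and "x \<in> V" "y \<in> V" "z \<in> V" "x \<noteq> z"
  shows "rooted V E {x, z} = joined V E {z} x y \<union> joined V E {x} z y"
    and "joined V E {z} x y \<inter> joined V E {x} z y = {}"
proof -
  have "conn A y x \<or> conn A y z" if A: "A \<in> rooted V E {x, z}" for A
  proof -
    have "simple_graph V A" using A simple_graph_subset[OF G] by (auto simp: rooted_def)
    from rank_eq_spanning[OF this, of "{x, z}" y] A assms show ?thesis by (auto simp: rooted_def)
  qed
  then show "rooted V E {x, z} = joined V E {z} x y \<union> joined V E {x} z y"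
    by (auto simp: joined_def insert_commute)
  show "joined V E {z} x y \<inter> joined V E {x} z y = {}"
  proof -
    have False if "separated A {x, z}" "conn A y x" "conn A y z" for A
    proof -
      have "conn A x z" using that conn_sym conn_trans by metis
      then show False using that(1) assms(5) by (auto simp: separated_def)
    qed
    then show ?thesis by (auto simp: joined_def rooted_def)
  qed
qed

text \<open>Let \<open>h\<close> be the potential of a source at \<open>a\<close> with
  \<open>b\<close>, \<open>c\<close> grounded, and \<open>p\<close>, \<open>q\<close> those of
  sources at \<open>a\<close>, \<open>b\<close> with only \<open>c\<close> grounded. Then
  \<open>f0 * h\<close> and \<open>q b * p - p b * q\<close> both vanish at \<open>b\<close> and
  \<open>c\<close> and have the same source at \<open>a\<close>, so they agree. Their values at
  \<open>a\<close> give f0 f123 = (fc + fb)(fc + fa) - fc^2.\<close>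

lemma three_forest_identity:
  assumes G: "simple_graph V E" and w: "\<And>e. e \<in> E \<Longrightarrow> w e > 0"
    and abc: "a \<in> V" "b \<in> V" "c \<in> V" "a \<noteq> b" "b \<noteq> c" "a \<noteq> c"
  defines "W \<equiv> forest_weight w"
  shows "W (rooted V E {c}) * W (rooted V E {a, b, c}) =
    W (joined V E {c} a b) * W (joined V E {a} b c) +
    W (joined V E {c} a b) * W (joined V E {b} a c) +
    W (joined V E {a} b c) * W (joined V E {b} a c)"
proof -
  let ?fc = "W (joined V E {c} a b)" and ?fa = "W (joined V E {a} b c)" and ?fb = "W (joined V E {b} a c)"
  let ?f0 = "W (rooted V E {c})"
  have W_un: "W (\<A> \<union> \<B>) = W \<A> + W \<B>" if "finite \<A>" "finite \<B>" "\<A> \<inter> \<B> = {}" for \<A> \<B>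
    unfolding W_def forest_weight_def using that by (rule sum.union_disjoint)
  have W_empty: "W {} = 0" by (simp add: W_def forest_weight_def)
  show ?thesis
  proof (cases "\<exists>T\<subseteq>E. tree V T")
    \<comment> \<open>Uniqueness requires every vertex to be joined to the ground, so this case is
      separate. Here f0 is 0, and two nonempty families would connect \<open>a\<close>,
      \<open>b\<close>, \<open>c\<close> and thereby yield a spanning tree.\<close>
    case False
    then have "rooted V E {c} = {}" unfolding rooted_singleton by blast
    then have "?f0 = 0" by (simp add: W_empty)
    moreover have conn: "conn E x y" if "joined V E S y x \<noteq> {}" for S x y
    proof -
      from that obtain A where "A \<subseteq> E" "conn A x y" by (auto simp: joined_def rooted_def)
      then show ?thesis using conn_mono by metis
    qed
    have none: "x = z \<or> \<not> conn E x z \<or> \<not> conn E x y \<or> joined V E {z} x y = {}" for x y z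
      using rooted_extend[OF G, of _ x z] False by (auto simp: joined_def)
    have "joined V E {c} a b = {} \<or> joined V E {a} b c = {}"
    proof (rule ccontr)
      assume n: "\<not> ?thesis"
      then have "conn E b a" "conn E c b" using conn by blast+
      then have "conn E a c" "conn E a b" using conn_sym conn_trans by metis+
      then show False using none[of a c b] n abc by blast
    qed
    moreover have "joined V E {c} a b = {} \<or> joined V E {b} a c = {}"
    proof (rule ccontr)
      assume n: "\<not> ?thesis"
      then have "conn E b a" "conn E c a" using conn by blast+
      then have "conn E a c" "conn E a b" using conn_sym by metis+
      then show False using none[of a c b] n abc by blast
    qed
    moreover have "joined V E {a} b c = {} \<or> joined V E {b} a c = {}"
    proof (rule ccontr)
      assume n: "\<not> ?thesis"
      then have "conn E c b" "conn E c a" using conn by blast+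
      then have "conn E b a" "conn E b c" using conn_sym conn_trans by metis+
      then show False using none[of b a c] n abc by blast
    qed
    ultimately show ?thesis by (auto simp: W_empty)
  next
    case True
    then obtain T where T: "T \<subseteq> E" "tree V T" by blast
    have con: "conn E x y" if "x \<in> V" "y \<in> V" for x y
      using tree_conn[OF simple_graph_subset[OF G T(1)] T(2) that] T(1) by (rule conn_mono)
    define p q h where "p x = W (joined V E {c} a x)" and "q x = W (joined V E {c} b x)"
      and "h x = W (joined V E {b, c} a x)" for x
    have Rac: "p a = ?fc + ?fa"
      using joined_split[OF G abc(1,2,3,6)] joined_commute[of c a b V E] abc finite_joined[OF G]
      by (simp add: p_def joined_self W_un)
    have Rbc: "q b = ?fc + ?fb"
      using joined_split[OF G abc(2,1,3,5)] joined_commute[of c b a V E] joined_commute[of b c a V E] abc finite_joined[OF G]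
      by (simp add: q_def joined_self W_un)
    have Rbc': "q b = W (rooted V E {b, c})" by (simp add: q_def joined_self)
    have pb: "p b = ?fc" by (simp add: p_def)
    have qa: "q a = ?fc" using joined_commute[of b c a V E] abc by (simp add: q_def)
    let ?k = "\<lambda>x. ?f0 * h x - (q b * p x - p b * q x)"
    have "?k a = 0"
    proof (rule harmonic_eq_0[OF G w])
      show "?k x = 0" if "x \<in> {b, c}" for x
      proof -
        have "h x = 0" using that abc joined_root[of x "{b, c}" a V E] by (auto simp: h_def W_empty)
        moreover have "p c = 0" "q c = 0"
          using abc joined_root[of c "{c}" a V E] joined_root[of c "{c}" b V E] by (auto simp: p_def q_def W_empty)
        ultimately show ?thesis using that by auto
      qed
      show "\<exists>s\<in>{b, c}. conn E x s" if "x \<in> V" for x using con[OF that abc(2)] by blast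
      show "a \<in> V" by fact
      fix x assume x: "x \<in> V - {b, c}"
      let ?L = "\<lambda>f. \<Sum>z | {x, z} \<in> E. w {x, z} * (f x - f z)"
      have Lp: "?L p = of_bool (x = a) * ?f0"
        using current_law[OF G, of "{c}" a x w] abc x by (auto simp: p_def W_def)
      have Lq: "?L q = 0"
        using current_law[OF G, of "{c}" b x w] abc x by (auto simp: q_def W_def)
      have Lh: "?L h = of_bool (x = a) * q b"
        using current_law[OF G, of "{b, c}" a x w] abc x by (auto simp: h_def Rbc' W_def)
      have "?L ?k = (\<Sum>z | {x, z} \<in> E. ?f0 * (w {x, z} * (h x - h z)) -
          (q b * (w {x, z} * (p x - p z)) - p b * (w {x, z} * (q x - q z))))"
        by (rule sum.cong[OF refl]) (simp add: algebra_simps)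
      also have "\<dots> = ?f0 * ?L h - (q b * ?L p - p b * ?L q)"
        by (simp only: sum_subtractf sum_distrib_left)
      also have "\<dots> = 0" unfolding Lp Lq Lh by simp
      finally show "?L ?k = 0" .
    qed
    moreover have "h a = W (rooted V E {a, b, c})" by (simp add: h_def joined_self)
    ultimately have "?f0 * W (rooted V E {a, b, c}) = (?fc + ?fb) * (?fc + ?fa) - ?fc * ?fc"
      unfolding Rac Rbc pb qa by simp
    then show ?thesis by (simp add: algebra_simps)
  qed
qed

text \<open>The value of the Kirchhoff-type polynomial of a family of forests, modulo 2, at the point
  whose coordinates are 1 on \<open>X\<close> and 0 elsewhere.\<close>

definition forest_parity :: "'a set set \<Rightarrow> 'a set set \<Rightarrow> 'a set set set \<Rightarrow> bit" where
  "forest_parity E X \<A> = (\<Sum>A\<in>\<A>. of_bool (E - A \<subseteq> X))"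

text \<open>Both sides are homogeneous of degree 2 in \<open>W\<close>, so the factor that turns
  forest weights into products over complements occurs squared throughout and cancels. This leaves
  an identity of natural numbers, which can be reduced modulo 2.\<close>

lemma three_forest_identity_parity:
  fixes X :: "'a set set"
  assumes G: "simple_graph V E" 
    and abc: "a \<in> V" "b \<in> V" "c \<in> V" "a \<noteq> b" "b \<noteq> c" "a \<noteq> c"
  defines "W \<equiv> forest_parity E X"
  shows "W (rooted V E {c}) * W (rooted V E {a, b, c}) =
    W (joined V E {c} a b) * W (joined V E {a} b c) +
    W (joined V E {c} a b) * W (joined V E {b} a c) +
    W (joined V E {a} b c) * W (joined V E {b} a c)"
proof -
  note finE = simple_graph_finite(2)[OF G]
  \<comment> \<open>Lifting the coordinate 0 to 2 makes all weights positive without changing parities.\<close>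
  define x :: "'a set \<Rightarrow> nat" where "x e = (if e \<in> X then 1 else 2)" for e
  define K where "K \<A> = (\<Sum>A\<in>\<A>. \<Prod>e\<in>E - A. x e)" for \<A>
  define D where "D = real (\<Prod>e\<in>E. x e)"
  have xpos: "x e > 0" for e by (simp add: x_def)
  then have D: "D \<noteq> 0" by (simp add: D_def finE)
  \<comment> \<open>With reciprocal weights, the product over a forest is the product over its
    complement divided by the product over all edges.\<close>
  have FW: "forest_weight (\<lambda>e. 1 / real (x e)) \<A> = real (K \<A>) / D" if "\<A> \<subseteq> Pow E" for \<A>
  proof -
    have "(\<Prod>e\<in>A. 1 / real (x e)) = real (\<Prod>e\<in>E - A. x e) / D" if "A \<in> \<A>" for A
    proof -
      have "A \<subseteq> E" using that \<open>\<A> \<subseteq> Pow E\<close> by blast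
      then have "D = real (\<Prod>e\<in>E - A. x e) * real (\<Prod>e\<in>A. x e)"
        using finE prod.subset_diff[of A E x] unfolding D_def by (metis of_nat_mult)
      moreover have "real (\<Prod>e\<in>E - A. x e) \<noteq> 0" using xpos finE by simp
      ultimately show ?thesis by (simp add: prod_dividef)
    qed
    then show ?thesis unfolding forest_weight_def K_def by (simp add: sum_divide_distrib)
  qed
  have KW: "(of_nat (K \<A>) :: bit) = W \<A>" for \<A>
  proof -
    have "(of_nat (\<Prod>e\<in>E - A. x e) :: bit) = of_bool (E - A \<subseteq> X)" for A
    proof (cases "E - A \<subseteq> X")
      case True
      then have "(\<Prod>e\<in>E - A. x e) = 1" by (intro prod.neutral) (auto simp: x_def)
      then show ?thesis using True by simp
    next
      case False
      then obtain e where e: "e \<in> E - A" "e \<notin> X" by blast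
      then have "x e dvd (\<Prod>e\<in>E - A. x e)" using finE by (intro dvd_prodI) auto
      then have "even (\<Prod>e\<in>E - A. x e)" using e by (simp add: x_def)
      then show ?thesis using False by (simp add: of_nat_bit)
    qed
    then show ?thesis unfolding K_def W_def forest_parity_def of_nat_sum by simp
  qed
  have sub: "rooted V E S \<subseteq> Pow E" "joined V E S y z \<subseteq> Pow E" for S y z
    by (auto simp: rooted_def joined_def)
  have "K (rooted V E {c}) * K (rooted V E {a, b, c}) =
    K (joined V E {c} a b) * K (joined V E {a} b c) +
    K (joined V E {c} a b) * K (joined V E {b} a c) +
    K (joined V E {a} b c) * K (joined V E {b} a c)" (is "?l = ?r")
  proof -
    have "real ?l / (D * D) = real ?r / (D * D)"
      using three_forest_identity[OF G _ abc, of "\<lambda>e. 1 / real (x e)"] xpos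
      by (simp add: FW[OF sub(1)] FW[OF sub(2)] add_divide_distrib)
    then have "real ?l = real ?r" using D by (simp only: divide_cancel_right) simp
    then show ?thesis by (simp only: of_nat_eq_iff)
  qed
  from arg_cong[OF this, of "of_nat :: nat \<Rightarrow> bit"] show ?thesis by (simp add: KW)
qed

section \<open>Adding a vertex\<close>

definition star :: "'a \<Rightarrow> 'a set \<Rightarrow> 'a set set" where
  "star w D = (\<lambda>x. {w, x}) ` D"

lemma star_insert: "star w (insert x D) = insert {w, x} (star w D)"
  by (simp add: star_def)

lemma mem_star [simp]: "x \<noteq> w \<Longrightarrow> {w, x} \<in> star w D \<longleftrightarrow> x \<in> D"
  by (auto simp: star_def doubleton_eq_iff)

lemma star_conn:
  assumes "\<And>e. e \<in> A \<Longrightarrow> w \<notin> e" "w \<notin> D" "d \<noteq> w"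
  shows "conn (A \<union> star w D) w d \<longleftrightarrow> (\<exists>x\<in>D. conn A x d)"
proof
  assume c: "conn (A \<union> star w D) w d"
  have "d = w \<or> (\<exists>x\<in>D. conn A x d)"
  proof (rule conn_preserved[OF c])
    fix u v assume uv: "{u, v} \<in> A \<union> star w D" and u: "u = w \<or> (\<exists>x\<in>D. conn A x u)"
    show "v = w \<or> (\<exists>x\<in>D. conn A x v)"
    proof (cases "{u, v} \<in> A")
      case True
      then have "u \<noteq> w" using assms(1) by blast
      then show ?thesis using u conn_step[OF _ True] by blast
    next
      case False
      then obtain x where "x \<in> D" "{u, v} = {w, x}" using uv by (auto simp: star_def)
      then show ?thesis by (metis conn_refl doubleton_eq_iff)
    qed
  qed simp
  then show "\<exists>x\<in>D. conn A x d" using assms(3) by blast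
next
  assume "\<exists>x\<in>D. conn A x d"
  then obtain x where x: "x \<in> D" "conn A x d" by blast
  have "conn (A \<union> star w D) x d" using x(2) by (rule conn_mono) auto
  moreover have "conn (A \<union> star w D) w x" using x(1) by (intro conn_edge) (auto simp: star_def)
  ultimately show "conn (A \<union> star w D) w d" by (meson conn_trans)
qed

text \<open>Joining \<open>w\<close> to two vertices of one component closes a cycle, and joining it
  to different components never does.\<close>

lemma indep_star:
  assumes "\<And>e. e \<in> A \<Longrightarrow> w \<notin> e" "finite D" "w \<notin> D"
  shows "indep (A \<union> star w D) \<longleftrightarrow> indep A \<and> separated A D"
  using assms(2,3)
proof (induction D rule: finite_induct)
  case empty
  then show ?case by (simp add: star_def separated_def)
next
  case (insert x D)
  have "{w, x} \<notin> A \<union> star w D" using assms(1) insert by auto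
  then have "indep (insert {w, x} (A \<union> star w D)) \<longleftrightarrow>
      indep A \<and> separated A D \<and> \<not> (\<exists>y\<in>D. conn A y x)"
    using insert star_conn[of A w D x] assms(1) by (auto simp: indep_insert)
  moreover have "separated A (insert x D) \<longleftrightarrow> separated A D \<and> \<not> (\<exists>y\<in>D. conn A y x)"
    using insert.hyps(2) by (auto simp: separated_def dest: conn_sym)
  ultimately show ?case by (simp add: star_insert)
qed

lemma prod_of_bool_bit:
  "finite S \<Longrightarrow> (\<Prod>e\<in>S. of_bool (Q e) :: bit) = of_bool (\<forall>e\<in>S. Q e)"
  by (induction S rule: finite_induct) auto

lemma of_int_bit: "(of_int k :: bit) = of_bool (odd k)"
proof (cases k rule: int_cases2)
  case (nonneg n)
  then show ?thesis by (simp add: of_nat_bit)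
next
  case (nonpos n)
  then show ?thesis by (simp add: of_nat_bit)
qed

locale star_graph =
  fixes V :: "'a set" and E :: "'a set set" and w :: 'a and N :: "'a set"
  assumes graph: "simple_graph V E" and w: "w \<notin> V" and N: "N \<subseteq> V" and V_ne: "V \<noteq> {}"
begin

lemma finV: "finite V" and finE: "finite E" and finN: "finite N" and wN: "w \<notin> N"
  using simple_graph_finite[OF graph] N w finite_subset by auto

lemma wE: "e \<in> E \<Longrightarrow> w \<notin> e"
  using graph w by (auto simp: simple_graph_def)

lemma E_star: "E \<inter> star w D = {}"
  using wE by (auto simp: star_def)

lemma simple_star: "simple_graph (insert w V) (E \<union> star w N)"
proof -
  have "card {w, x} = 2" if "x \<in> N" for x
    using that wN by (metis card_2_iff)
  then show ?thesis using graph N finV by (auto simp: simple_graph_def star_def)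
qed

lemma fin_star: "D \<subseteq> N \<Longrightarrow> finite (star w D)"
  using finN finite_subset by (auto simp: star_def)

lemma star_tree:
  assumes "A \<subseteq> E" "D \<subseteq> N"
  shows "indep (A \<union> star w D) \<and> card (A \<union> star w D) + 1 = card (insert w V) \<longleftrightarrow> A \<in> rooted V E D"
proof -
  have fin: "finite A" "finite D" "w \<notin> D" using assms finE finN wN finite_subset by blast+
  have "card (A \<union> star w D) = card A + card (star w D)"
    using E_star assms fin by (intro card_Un_disjoint) (auto simp: star_def)
  also have "card (star w D) = card D"
    unfolding star_def by (rule card_image) (auto simp: inj_on_def doubleton_eq_iff)
  finally show ?thesis
    using indep_star[of A w D] wE assms fin w finV by (auto simp: rooted_def)
qed

text \<open>The value modulo 2 of the Kirchhoff polynomial of the graph with \<open>w\<close>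
  attached, expanded by the set \<open>D\<close> of star edges used by the tree; \<open>X\<close>
  and \<open>D'\<close> record the coordinates equal to 1 on \<open>E\<close> and on the
  star.\<close>

definition star_parity :: "'a set set \<Rightarrow> 'a set \<Rightarrow> bit" where
  "star_parity X D' = (\<Sum>D\<in>Pow N. of_bool (N - D \<subseteq> D') * forest_parity E X (rooted V E D))"

lemma star_inter:
  assumes "A \<subseteq> E" "D \<subseteq> N"
  shows "(A \<union> star w D) \<inter> E = A" "{x\<in>N. {w, x} \<in> A \<union> star w D} = D"
    "E \<union> star w N - (A \<union> star w D) = (E - A) \<union> star w (N - D)"
proof -
  show "(A \<union> star w D) \<inter> E = A" using E_star assms by blast
  have "x \<noteq> w" if "x \<in> N" for x using that wN by blast
  then show "{x\<in>N. {w, x} \<in> A \<union> star w D} = D"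
    using wE assms by auto
  have "star w N - star w D = star w (N - D)"
    unfolding star_def by (rule inj_on_image_set_diff[symmetric, where C = N])
      (use assms in \<open>auto simp: inj_on_def doubleton_eq_iff\<close>)
  then show "E \<union> star w N - (A \<union> star w D) = (E - A) \<union> star w (N - D)"
    using E_star assms(1) by blast
qed

lemma star_union:
  assumes "T \<subseteq> E \<union> star w N"
  shows "(T \<inter> E) \<union> star w {x\<in>N. {w, x} \<in> T} = T"
  using assms by (auto simp: star_def)

text \<open>A spanning tree is determined by its star edges, indexed by \<open>D\<close>, and the
  rest \<open>A\<close>. By \<open>star_tree\<close> the rest ranges over the forests rooted at
  \<open>D\<close>, and the monomial factors accordingly.\<close>

lemma kirchhoff_parity:
  "(of_int (kirchhoff (insert w V) (E \<union> star w N) \<alpha>) :: bit) =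
    star_parity {e\<in>E. odd (\<alpha> e)} {x\<in>N. odd (\<alpha> {w, x})}" (is "_ = star_parity ?X ?D")
proof -
  let ?E = "E \<union> star w N"
  have finE1: "finite ?E" using finE fin_star by blast
  have trees: "spanning_trees (insert w V) ?E = {T. T \<subseteq> ?E \<and> indep T \<and> card T + 1 = card (insert w V)}"
    using simple_star by (rule spanning_trees_indep) simp
  have "(of_int (kirchhoff (insert w V) ?E \<alpha>) :: bit) =
      (\<Sum>T\<in>spanning_trees (insert w V) ?E. of_bool (\<forall>e\<in>?E - T. odd (\<alpha> e)))"
    unfolding kirchhoff_def of_int_sum of_int_prod
    unfolding of_int_bit using finE1 by (simp add: prod_of_bool_bit)
  also have "\<dots> = (\<Sum>m\<in>Sigma (Pow N) (rooted V E). of_bool (N - fst m \<subseteq> ?D) * of_bool (E - snd m \<subseteq> ?X))"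
  proof (rule sum.reindex_bij_witness[of _ "\<lambda>(D, A). A \<union> star w D" "\<lambda>T. ({x\<in>N. {w, x} \<in> T}, T \<inter> E)"])
    fix T assume "T \<in> spanning_trees (insert w V) ?E"
    then have T: "T \<subseteq> ?E" "indep T" "card T + 1 = card (insert w V)" unfolding trees by auto
    let ?A = "T \<inter> E" and ?S = "{x\<in>N. {w, x} \<in> T}"
    have u: "?A \<union> star w ?S = T" using T(1) by (rule star_union)
    then show "(case (?S, ?A) of (D, A) \<Rightarrow> A \<union> star w D) = T" by simp
    show "(?S, ?A) \<in> Sigma (Pow N) (rooted V E)"
      using star_tree[of ?A ?S] T u by auto
    have "?E - T = (E - ?A) \<union> star w (N - ?S)"
      using star_inter(3)[of ?A ?S] unfolding u by auto
    then have "(\<forall>e\<in>?E - T. odd (\<alpha> e)) \<longleftrightarrow> N - ?S \<subseteq> ?D \<and> E - ?A \<subseteq> ?X"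
      by (auto simp: star_def)
    then show "of_bool (N - fst (?S, ?A) \<subseteq> ?D) * of_bool (E - snd (?S, ?A) \<subseteq> ?X) =
        (of_bool (\<forall>e\<in>?E - T. odd (\<alpha> e)) :: bit)" by auto
  next
    fix m assume "m \<in> Sigma (Pow N) (rooted V E)"
    then obtain D A where m: "m = (D, A)" "D \<subseteq> N" "A \<in> rooted V E D" by auto
    then have A: "A \<subseteq> E" by (simp add: rooted_def)
    show "({x\<in>N. {w, x} \<in> (case m of (D, A) \<Rightarrow> A \<union> star w D)}, (case m of (D, A) \<Rightarrow> A \<union> star w D) \<inter> E) = m"
      unfolding m(1) prod.case star_inter[OF A m(2)] ..
    have "A \<union> star w D \<subseteq> ?E" using A m(2) by (auto simp: star_def)
    then show "(case m of (D, A) \<Rightarrow> A \<union> star w D) \<in> spanning_trees (insert w V) ?E"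
      unfolding trees m(1) prod.case using star_tree[OF A m(2)] m(3) by blast
  qed
  also have "\<dots> = star_parity ?X ?D"
    unfolding star_parity_def forest_parity_def sum_distrib_left
    using finN finite_rooted[OF graph] by (subst sum.Sigma) (auto simp: case_prod_unfold)
  finally show ?thesis .
qed

lemma kirchhoff_points_star:
  "kirchhoff_points 2 (insert w V) (E \<union> star w N) =
    (\<Sum>X\<in>Pow E. card {D'\<in>Pow N. star_parity X D' = 0})"
proof -
  let ?E = "E \<union> star w N"
  let ?Z = "{\<alpha> \<in> ?E \<rightarrow>\<^sub>E {0..<int 2}. int 2 dvd kirchhoff (insert w V) ?E \<alpha>}"
  let ?f = "\<lambda>\<alpha>. ({e\<in>E. odd (\<alpha> e)}, {x\<in>N. odd (\<alpha> {w, x})})"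
  let ?g = "\<lambda>(X, D). restrict (\<lambda>e. of_bool (e \<in> X \<union> star w D)) ?E :: 'a set \<Rightarrow> int"
  have dvd: "int 2 dvd kirchhoff (insert w V) ?E \<alpha> \<longleftrightarrow> star_parity (fst (?f \<alpha>)) (snd (?f \<alpha>)) = 0" for \<alpha>
    unfolding fst_conv snd_conv kirchhoff_parity[symmetric] by (simp add: of_int_bit)
  have fg: "?f (?g m) = m" if m: "m \<in> Pow E \<times> Pow N" for m
  proof -
    obtain X D where XD: "m = (X, D)" "X \<subseteq> E" "D \<subseteq> N" using m by auto
    have "{e\<in>E. odd (?g m e)} = (X \<union> star w D) \<inter> E" using XD by auto
    moreover have "{x\<in>N. odd (?g m {w, x})} = {x\<in>N. {w, x} \<in> X \<union> star w D}"
      using XD by (auto simp: star_def)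
    ultimately show ?thesis using star_inter(1,2)[OF XD(2,3)] XD(1) by simp
  qed
  have "bij_betw ?f ?Z {(X, D')\<in>Pow E \<times> Pow N. star_parity X D' = 0}"
  proof (rule bij_betw_byWitness[where f' = ?g])
    show "\<forall>\<alpha>\<in>?Z. ?g (?f \<alpha>) = \<alpha>"
    proof
      fix \<alpha> assume "\<alpha> \<in> ?Z"
      then have \<alpha>: "\<alpha> \<in> ?E \<rightarrow>\<^sub>E {0..<int 2}" by simp
      show "?g (?f \<alpha>) = \<alpha>"
      proof
        fix e
        show "?g (?f \<alpha>) e = \<alpha> e"
        proof (cases "e \<in> ?E")
          case True
          then have "\<alpha> e \<in> {0..<int 2}" using \<alpha> by (auto simp: PiE_iff)
          then have "\<alpha> e = 0 \<or> \<alpha> e = 1" by auto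
          then have v: "\<alpha> e = of_bool (odd (\<alpha> e))" by auto
          have iff: "e \<in> {e\<in>E. odd (\<alpha> e)} \<union> star w {x\<in>N. odd (\<alpha> {w, x})} \<longleftrightarrow> odd (\<alpha> e)"
            using True E_star by (auto simp: star_def)
          show ?thesis unfolding prod.case restrict_apply if_P[OF True] iff using v by simp
        next
          case False
          then show ?thesis using \<alpha> by (simp add: PiE_iff extensional_def)
        qed
      qed
    qed
    show "\<forall>m\<in>{(X, D')\<in>Pow E \<times> Pow N. star_parity X D' = 0}. ?f (?g m) = m"
      using fg by blast
    show "?f ` ?Z \<subseteq> {(X, D')\<in>Pow E \<times> Pow N. star_parity X D' = 0}"
      using dvd by auto
    show "?g ` {(X, D')\<in>Pow E \<times> Pow N. star_parity X D' = 0} \<subseteq> ?Z"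
    proof
      fix \<alpha> assume "\<alpha> \<in> ?g ` {(X, D')\<in>Pow E \<times> Pow N. star_parity X D' = 0}"
      then obtain m where m: "m \<in> Pow E \<times> Pow N" "star_parity (fst m) (snd m) = 0" "\<alpha> = ?g m" by auto
      have "\<alpha> \<in> ?E \<rightarrow>\<^sub>E {0..<int 2}" unfolding m(3) by (auto split: prod.split)
      moreover have "?f \<alpha> = m" using fg[OF m(1)] m(3) by simp
      ultimately show "\<alpha> \<in> ?Z" using dvd[of \<alpha>] m(2) by simp
    qed
  qed
  then have "kirchhoff_points 2 (insert w V) ?E = card {(X, D')\<in>Pow E \<times> Pow N. star_parity X D' = 0}"
    unfolding kirchhoff_points_def by (rule bij_betw_same_card)
  also have "{(X, D')\<in>Pow E \<times> Pow N. star_parity X D' = 0} =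
      Sigma (Pow E) (\<lambda>X. {D'\<in>Pow N. star_parity X D' = 0})" by auto
  also have "card \<dots> = (\<Sum>X\<in>Pow E. card {D'\<in>Pow N. star_parity X D' = 0})"
    using finE finN by (intro card_SigmaI) auto
  finally show ?thesis .
qed

end

section \<open>The c2 invariant modulo 2\<close>

lemma sum_Pow_insert:
  assumes "finite S" "e \<notin> S"
  shows "(\<Sum>T\<in>Pow (insert e S). g T) = (\<Sum>T\<in>Pow S. g T) + (\<Sum>T\<in>Pow S. g (insert e T) :: 'b::comm_monoid_add)"
proof -
  have "inj_on (insert e) (Pow S)" using assms(2) by (auto simp: inj_on_def)
  moreover have "Pow S \<inter> insert e ` Pow S = {}" using assms(2) by auto
  ultimately show ?thesis
    unfolding Pow_insert using assms(1) by (simp add: sum.union_disjoint sum.reindex)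
qed

text \<open>The indicator is the monomial of \<open>B\<close> at the point \<open>X\<close>. A
  variable absent from \<open>B\<close> can be toggled freely, so its points cancel in pairs; this
  is the Chevalley-Warning argument over F_2.\<close>

lemma sum_superset_parity:
  assumes "finite E" "B \<subseteq> E"
  shows "(\<Sum>X\<in>Pow E. of_bool (B \<subseteq> X) :: bit) = of_bool (B = E)"
proof (cases "B = E")
  case True
  have "(\<Sum>X\<in>Pow E. of_bool (E \<subseteq> X) :: bit) = (\<Sum>X\<in>{E}. 1)"
    using assms(1) by (intro sum.mono_neutral_cong_right) auto
  then show ?thesis using True by simp
next
  case False
  then obtain e where e: "e \<in> E" "e \<notin> B" using assms(2) by blast
  define \<iota> where "\<iota> X = (if e \<in> X then X - {e} else insert e X)" for X
  have "(\<Sum>X\<in>Pow E. of_bool (B \<subseteq> X) :: bit) = 0"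
  proof (rule sum_involution_zero[where \<iota> = \<iota>])
    fix X assume "X \<in> Pow E"
    then show "\<iota> X \<in> Pow E \<and> \<iota> (\<iota> X) = X \<and> \<iota> X \<noteq> X \<and>
        (of_bool (B \<subseteq> \<iota> X) :: bit) = of_bool (B \<subseteq> X)"
      using e by (auto simp: \<iota>_def insert_absorb)
  qed (use assms(1) in simp)
  then show ?thesis using False by simp
qed

lemma sum_forest_parity:
  assumes "finite E" "finite \<A>" "\<And>A. A \<in> \<A> \<Longrightarrow> A \<subseteq> E \<and> A \<noteq> {}"
  shows "(\<Sum>X\<in>Pow E. forest_parity E X \<A>) = 0"
proof -
  have "(\<Sum>X\<in>Pow E. forest_parity E X \<A>) = (\<Sum>A\<in>\<A>. \<Sum>X\<in>Pow E. of_bool (E - A \<subseteq> X))"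
    unfolding forest_parity_def by (rule sum.swap)
  also have "\<dots> = (\<Sum>A\<in>\<A>. 0)"
  proof (rule sum.cong[OF refl])
    fix A assume "A \<in> \<A>"
    then have "E - A \<noteq> E" using assms(3) by blast
    then show "(\<Sum>X\<in>Pow E. of_bool (E - A \<subseteq> X) :: bit) = 0"
      using sum_superset_parity[OF assms(1), of "E - A"] by simp
  qed
  finally show ?thesis by simp
qed

text \<open>The sizes make the two complements together have exactly \<open>card E\<close> elements.
  They exhaust \<open>E\<close> only if they are disjoint, that is, if \<open>A\<close> and
  \<open>B\<close> are complementary.\<close>

lemma sum_forest_parity_mult:
  assumes "finite E" "finite \<A>" "finite \<B>"
    and sub: "\<And>A B. A \<in> \<A> \<Longrightarrow> B \<in> \<B> \<Longrightarrow> A \<subseteq> E \<and> B \<subseteq> E \<and> card A + card B = card E"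
  shows "(\<Sum>X\<in>Pow E. forest_parity E X \<A> * forest_parity E X \<B>) = (\<Sum>A\<in>\<A>. of_bool (E - A \<in> \<B>))"
proof -
  have "(\<Sum>X\<in>Pow E. forest_parity E X \<A> * forest_parity E X \<B>) =
      (\<Sum>X\<in>Pow E. \<Sum>A\<in>\<A>. \<Sum>B\<in>\<B>. of_bool ((E - A) \<union> (E - B) \<subseteq> X))"
    unfolding forest_parity_def sum_product by (intro sum.cong refl) auto
  also have "\<dots> = (\<Sum>A\<in>\<A>. \<Sum>X\<in>Pow E. \<Sum>B\<in>\<B>. of_bool ((E - A) \<union> (E - B) \<subseteq> X))"
    by (rule sum.swap)
  also have "\<dots> = (\<Sum>A\<in>\<A>. \<Sum>B\<in>\<B>. \<Sum>X\<in>Pow E. of_bool ((E - A) \<union> (E - B) \<subseteq> X))"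
    by (intro sum.cong refl sum.swap)
  also have "\<dots> = (\<Sum>A\<in>\<A>. \<Sum>B\<in>\<B>. of_bool (B = E - A))"
  proof (intro sum.cong refl)
    fix A B assume AB: "A \<in> \<A>" "B \<in> \<B>"
    note s = sub[OF AB]
    have "(E - A) \<union> (E - B) = E \<longleftrightarrow> B = E - A"
    proof
      assume "(E - A) \<union> (E - B) = E"
      then have "B \<subseteq> E - A" using s by blast
      moreover have "card B = card (E - A)"
        using s assms(1) by (metis card_Diff_subset diff_add_inverse finite_subset)
      ultimately show "B = E - A" using assms(1) by (simp add: card_subset_eq)
    qed (use s in auto)
    then show "(\<Sum>X\<in>Pow E. of_bool ((E - A) \<union> (E - B) \<subseteq> X) :: bit) = of_bool (B = E - A)"
      using sum_superset_parity[OF assms(1), of "(E - A) \<union> (E - B)"] by auto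
  qed
  also have "\<dots> = (\<Sum>A\<in>\<A>. of_bool (E - A \<in> \<B>))"
    using assms(3) by (intro sum.cong refl) (simp add: of_bool_def)
  finally show ?thesis .
qed

text \<open>For \<open>f0 = 1\<close> the hypothesis turns the polynomial into
  \<open>b1 b2 + b1 b3 + b2 b3\<close> with \<open>bi = ti + fi\<close>, which has 4 zeros; for \<open>f0 = 0\<close> it is affine.\<close>

lemma cubic_zeros:
  fixes f0 fa fb fc g :: bit
  assumes "f0 * g = fc * fa + fc * fb + fa * fb"
  defines "\<psi> \<equiv> \<lambda>t1 t2 t3. of_bool (t2 \<and> t3) * f0 + of_bool (t1 \<and> t3) * f0 + of_bool (t1 \<and> t2) * f0 +
      of_bool t3 * (fa + fb) + of_bool t2 * (fa + fc) + of_bool t1 * (fb + fc) + g"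
  shows "(\<Sum>t1\<in>UNIV. \<Sum>t2\<in>UNIV. \<Sum>t3\<in>UNIV. of_bool (\<psi> t1 t2 t3 = 0)) =
    4 * (if f0 = 0 \<and> fa = 0 \<and> fb = 0 \<and> fc = 0 then 2 * of_bool (g = 0) else 1 :: nat)"
  using assms(1) unfolding \<psi>_def UNIV_bool
  by (cases f0; cases fa; cases fb; cases fc; cases g) simp_all

lemma sum_Pow_3:
  assumes "a \<noteq> b" "b \<noteq> c" "a \<noteq> c"
  shows "(\<Sum>D\<in>Pow {a, b, c}. g D :: 'b::comm_monoid_add) =
    g {} + g {c} + (g {b} + g {b, c}) + (g {a} + g {a, c} + (g {a, b} + g {a, b, c}))"
  using assms by (simp add: sum_Pow_insert)

text \<open>\<open>edges\<close> is |E| = (|V| - 1) + (|V| - 2), the size at which a spanning tree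
  and a spanning 2-forest can be complementary.\<close>

lemma c2_star:
  assumes G: "simple_graph V E" and w: "w \<notin> V" and r: "r \<in> V"
    and abc: "a \<in> V" "b \<in> V" "c \<in> V" "a \<noteq> b" "b \<noteq> c" "a \<noteq> c"
    and edges: "card E + 3 = 2 * card V" and odd: "odd (card V)"
  shows "(of_nat (c2 2 (insert w V) (E \<union> star w {a, b, c})) :: bit) =
    (\<Sum>T\<in>tree_splits.splits V E. of_bool (crosses (tree_splits.side E r T) {a, b, c}))"
proof -
  interpret star_graph V E w "{a, b, c}" by unfold_locales (use G w abc in auto)
  interpret tree_splits V E r by unfold_locales (use G r odd in auto)
  have "card {a, b, c} \<le> card V" using abc finV by (intro card_mono) auto
  then have V3: "card V \<ge> 3" using abc by simp
  define f where "f \<A> X = forest_parity E X \<A>" for \<A> X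
  define f0 fa fb fc g where "f0 = f (rooted V E {c})" and "fa = f (joined V E {a} b c)"
    and "fb = f (joined V E {b} a c)" and "fc = f (joined V E {c} a b)" and "g = f (rooted V E {a, b, c})"
  have split: "f (rooted V E {x, z}) X = f (joined V E {z} x y) X + f (joined V E {x} z y) X"
    if "x \<in> V" "y \<in> V" "z \<in> V" "x \<noteq> z" for x y z X
    unfolding f_def forest_parity_def joined_split(1)[OF G that]
    by (rule sum.union_disjoint[OF finite_joined[OF G] finite_joined[OF G] joined_split(2)[OF G that]])
  have ab: "f (rooted V E {a, b}) X = fa X + fb X" for X
    using split[of a c b] abc by (simp add: fa_def fb_def add.commute)
  have ac: "f (rooted V E {a, c}) X = fa X + fc X" for X
    using split[of a b c] abc joined_commute[of c a b V E] by (simp add: fa_def fc_def add.commute)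
  have bc: "f (rooted V E {b, c}) X = fb X + fc X" for X
    using split[of b a c] abc joined_commute[of c b a V E] joined_commute[of b c a V E]
    by (simp add: fb_def fc_def add.commute)
  have single: "f (rooted V E {x}) X = f0 X" for x X by (simp add: f0_def rooted_singleton)
  have none: "f (rooted V E {}) X = 0" for X
    using rooted_empty[OF G] V_ne by (simp add: f_def forest_parity_def)
  have joined2: "A \<subseteq> E \<and> card A + 2 = card V" if "A \<in> joined V E {z} x y" "x \<noteq> z" for A x y z
    using that by (simp add: joined_def rooted_def)
  let ?\<psi> = "\<lambda>X t1 t2 t3. of_bool (t2 \<and> t3) * f0 X + of_bool (t1 \<and> t3) * f0 X + of_bool (t1 \<and> t2) * f0 X +
      of_bool t3 * (fa X + fb X) + of_bool t2 * (fa X + fc X) + of_bool t1 * (fb X + fc X) + g X"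
  have diffs: "{a, b, c} - {a} = {b, c}" "{a, b, c} - {b} = {a, c}" "{a, b, c} - {c} = {a, b}"
    "{a, b, c} - {a, b} = {c}" "{a, b, c} - {a, c} = {b}" "{a, b, c} - {b, c} = {a}" "{a, b, c} - {a, b, c} = {}"
    using abc by auto
  have parity: "star_parity X D' = ?\<psi> X (a \<in> D') (b \<in> D') (c \<in> D')" for X D'
    unfolding star_parity_def f_def[symmetric] sum_Pow_3[OF abc(4,5,6)] diffs ab ac bc single none g_def[symmetric]
    by (simp add: ac_simps)
  have id: "f0 X * g X = fc X * fa X + fc X * fb X + fa X * fb X" for X
    unfolding f0_def g_def fa_def fb_def fc_def f_def using G abc by (rule three_forest_identity_parity)
  \<comment> \<open>For fixed \<open>X\<close> the 8 choices of star coordinates contain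
    \<open>4 * ?m X\<close> zeros. Dividing by 2^2 leaves \<open>?m X\<close>, which is even in the
    degenerate case.\<close>
  let ?zero = "\<lambda>X. f0 X = 0 \<and> fa X = 0 \<and> fb X = 0 \<and> fc X = 0"
  let ?m = "\<lambda>X. if ?zero X then 2 * of_bool (g X = 0) else 1 :: nat"
  have count: "card {D'\<in>Pow {a, b, c}. star_parity X D' = 0} = 4 * ?m X" for X
  proof -
    have "card {D'\<in>Pow {a, b, c}. star_parity X D' = 0} = (\<Sum>D'\<in>Pow {a, b, c}. of_bool (star_parity X D' = 0))"
      by (simp add: sum_of_bool_eq Int_def)
    also have "\<dots> = (\<Sum>t1\<in>UNIV. \<Sum>t2\<in>UNIV. \<Sum>t3\<in>UNIV. of_bool (?\<psi> X t1 t2 t3 = 0))"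
      unfolding sum_Pow_3[OF abc(4,5,6)] parity UNIV_bool using abc by simp
    also have "\<dots> = 4 * ?m X" using cubic_zeros[OF id[of X]] .
    finally show ?thesis .
  qed
  have "c2 2 (insert w V) (E \<union> star w {a, b, c}) = (\<Sum>X\<in>Pow E. ?m X) mod 2"
    unfolding c2_def kirchhoff_points_star count by (simp flip: sum_distrib_left)
  then have "(of_nat (c2 2 (insert w V) (E \<union> star w {a, b, c})) :: bit) = of_nat (\<Sum>X\<in>Pow E. ?m X)"
    by (simp add: of_nat_bit)
  \<comment> \<open>By \<open>id\<close>, at most one of \<open>fa\<close>, \<open>fb\<close>,
    \<open>fc\<close> is 1 when \<open>f0\<close> is 0. Hence this quadratic polynomial is the
    indicator that the four values do not all vanish.\<close>
  also have "\<dots> = (\<Sum>X\<in>Pow E. f0 X + fa X + fb X + fc X + (f0 X * fa X + f0 X * fb X + f0 X * fc X))"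
    unfolding of_nat_sum
  proof (rule sum.cong[OF refl])
    fix X
    show "(of_nat (?m X) :: bit) = f0 X + fa X + fb X + fc X + (f0 X * fa X + f0 X * fb X + f0 X * fc X)"
      using id[of X] by (cases "f0 X"; cases "fa X"; cases "fb X"; cases "fc X") simp_all
  qed
  also have "\<dots> = (\<Sum>X\<in>Pow E. f0 X * fa X) + (\<Sum>X\<in>Pow E. f0 X * fb X) + (\<Sum>X\<in>Pow E. f0 X * fc X)"
  proof -
    \<comment> \<open>Since |V| is at least 3, trees and 2-forests have an edge, so each monomial
      misses a variable.\<close>
    have zero: "(\<Sum>X\<in>Pow E. f \<A> X) = 0" if "finite \<A>" "\<And>A. A \<in> \<A> \<Longrightarrow> A \<subseteq> E \<and> card A + 2 \<ge> card V" for \<A>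
      unfolding f_def using that V3 by (intro sum_forest_parity finE) fastforce+
    have "(\<Sum>X\<in>Pow E. f0 X) = 0"
      unfolding f0_def by (rule zero[OF finite_rooted[OF G]]) (simp add: rooted_def)
    moreover have "(\<Sum>X\<in>Pow E. fa X) = 0" "(\<Sum>X\<in>Pow E. fb X) = 0" "(\<Sum>X\<in>Pow E. fc X) = 0"
      unfolding fa_def fb_def fc_def using joined2 abc by (intro zero finite_joined[OF G]; simp)+
    ultimately show ?thesis by (simp add: sum.distrib)
  qed
  also have "\<dots> = (\<Sum>T\<in>rooted V E {c}. of_bool (E - T \<in> joined V E {a} b c)) +
      (\<Sum>T\<in>rooted V E {c}. of_bool (E - T \<in> joined V E {b} a c)) +
      (\<Sum>T\<in>rooted V E {c}. of_bool (E - T \<in> joined V E {c} a b))"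
  proof -
    have mult: "(\<Sum>X\<in>Pow E. f0 X * f \<B> X) = (\<Sum>T\<in>rooted V E {c}. of_bool (E - T \<in> \<B>))"
      if "finite \<B>" "\<And>B. B \<in> \<B> \<Longrightarrow> B \<subseteq> E \<and> card B + 2 = card V" for \<B>
      unfolding f_def f0_def
    proof (rule sum_forest_parity_mult[OF finE finite_rooted[OF G] that(1)])
      fix A B assume "A \<in> rooted V E {c}" "B \<in> \<B>"
      then show "A \<subseteq> E \<and> B \<subseteq> E \<and> card A + card B = card E"
        using that(2)[of B] edges by (auto simp: rooted_def)
    qed
    show ?thesis
      unfolding fa_def fb_def fc_def using joined2 abc
      by (simp add: mult[OF finite_joined[OF G]])
  qed
  \<comment> \<open>If the three vertices are not all on one side, exactly one of them is apart from
    the other two, so exactly one of the three terms is 1.\<close>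
  also have "\<dots> = (\<Sum>T\<in>rooted V E {c}. of_bool (T \<in> splits \<and> crosses (side T) {a, b, c}))"
    unfolding sum.distrib[symmetric]
  proof (rule sum.cong[OF refl])
    fix T assume "T \<in> rooted V E {c}"
    then have T: "T \<subseteq> E" "tree V T" by (auto simp: rooted_singleton)
    have j: "E - T \<in> joined V E {z} x y \<longleftrightarrow> T \<in> splits \<and> side T x = side T y \<and> side T x \<noteq> side T z"
      if "x \<in> V" "y \<in> V" "z \<in> V" "x \<noteq> z" for x y z
    proof -
      have "E - T \<in> joined V E {z} x y \<longleftrightarrow> T \<in> splits \<and> conn (E - T) x y \<and> \<not> conn (E - T) x z"
        using T that(4) by (auto simp: joined_def rooted_def separated_def splits_def two_forest_def dest: conn_sym)
      then show ?thesis using side_conn that by blast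
    qed
    have "crosses (side T) {a, b, c} \<longleftrightarrow> \<not> (side T a = side T b \<and> side T b = side T c)"
      by (auto simp: crosses_def)
    then show "of_bool (E - T \<in> joined V E {a} b c) + of_bool (E - T \<in> joined V E {b} a c) +
        of_bool (E - T \<in> joined V E {c} a b) = (of_bool (T \<in> splits \<and> crosses (side T) {a, b, c}) :: bit)"
      using j[of b c a] j[of a c b] j[of a b c] abc
      by (cases "side T a"; cases "side T b"; cases "side T c"; cases "T \<in> splits") simp_all
  qed
  also have "\<dots> = (\<Sum>T\<in>splits. of_bool (crosses (side T) {a, b, c}))"
    using finite_rooted[OF G, of "{c}"]
    by (intro sum.mono_neutral_cong_right) (auto simp: rooted_singleton splits_def)
  finally show ?thesis .
qed

section \<open>Deleting one of two adjacent vertices\<close>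

lemma degree_card_neighbours:
  assumes "simple_graph V E"
  shows "degree E v = card {x. {v, x} \<in> E}"
proof -
  have "{e\<in>E. v \<in> e} = (\<lambda>x. {v, x}) ` {x. {v, x} \<in> E}"
  proof (intro set_eqI iffI)
    fix e assume "e \<in> {e\<in>E. v \<in> e}"
    then have e: "e \<in> E" "v \<in> e" by auto
    from assms e(1) obtain x y where "e = {x, y}" by (rule simple_graph_edgeE)
    with e show "e \<in> (\<lambda>x. {v, x}) ` {x. {v, x} \<in> E}" by (auto simp: insert_commute)
  qed auto
  moreover have "inj_on (\<lambda>x. {v, x}) {x. {v, x} \<in> E}"
    by (auto simp: inj_on_def doubleton_eq_iff)
  ultimately show ?thesis by (simp add: degree_def card_image)
qed

text \<open>Both graphs arise from the same H by attaching one vertex; adjacency of \<open>v\<close>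
  and \<open>w\<close> leaves it exactly three neighbours in H. Both invariants are therefore sums
  over the same splittings, and only the 3-set to be separated differs.\<close>

lemma c2_adjacent:
  fixes V :: "'a set" and E :: "'a set set"
  assumes G: "simple_graph V E" and reg: "regular 4 V E" and odd: "odd (card V)"
    and v: "v \<in> V" and w: "w \<in> V" and vw: "{v, w} \<in> E"
  shows "c2 2 (del_vertex_V V v) (del_vertex_E E v) = c2 2 (del_vertex_V V w) (del_vertex_E E w)"
proof -
  define H D where "H = V - {v, w}" and "D = {e\<in>E. v \<notin> e \<and> w \<notin> e}"
  define M where "M u = {x. {u, x} \<in> E} - {v, w}" for u
  have ne: "v \<noteq> w" using G vw by (auto simp: simple_graph_def)
  have finV: "finite V" and finE: "finite E" using simple_graph_finite[OF G] by auto
  have loop: "{x} \<notin> E" for x using G by (auto simp: simple_graph_def)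
  have deg: "card {x. {u, x} \<in> E} = 4" if "u \<in> V" for u
    using reg that degree_card_neighbours[OF G] by (simp add: regular_def)
  have fin: "finite {x. {u, x} \<in> E}" for u using G by (rule finite_neighbours)
  have wv: "{w, v} \<in> E" using vw by (simp add: insert_commute)
  have M: "M v = {x. {v, x} \<in> E} - {w}" "M w = {x. {w, x} \<in> E} - {v}"
    using loop by (auto simp: M_def)
  have cardM: "card (M v) = 3" "card (M w) = 3"
    using deg[OF v] deg[OF w] vw wv unfolding M by (simp_all add: card_Diff_singleton)
  have MH: "M u \<subseteq> H" for u
    using simple_graph_neighbour[OF G] by (auto simp: M_def H_def)
  have HD: "simple_graph H D" using G by (auto simp: simple_graph_def H_def D_def)
  have cardH: "card H + 2 = card V"
    using v w ne finV card_Diff_subset[of "{v, w}" V] card_mono[of V "{v, w}"] by (simp add: H_def)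
  then have oddH: "odd (card H)" using odd by presburger
  have degH: "degree D x + of_bool (x \<in> M w) + of_bool (x \<in> M v) = 4" if x: "x \<in> H" for x
  proof -
    have "{y. {x, y} \<in> D} = {y. {x, y} \<in> E} - {v, w}"
      using x by (auto simp: D_def H_def)
    moreover have "x \<in> M w \<longleftrightarrow> w \<in> {y. {x, y} \<in> E}" "x \<in> M v \<longleftrightarrow> v \<in> {y. {x, y} \<in> E}"
      using x by (auto simp: M_def H_def insert_commute)
    moreover have drop: "card (S - {v, w}) + of_bool (w \<in> S) + of_bool (v \<in> S) = card S" if "finite S" for S
    proof -
      have "card S = card (S - {v, w}) + card (S \<inter> {v, w})"
        using that by (metis card_Diff_subset_Int card_mono finite_Int inf_le1 le_add_diff_inverse2)
      moreover have "S \<inter> {v, w} = (if v \<in> S then {v} else {}) \<union> (if w \<in> S then {w} else {})" by auto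
      ultimately show ?thesis using ne by auto
    qed
    ultimately show ?thesis
      using deg[of x] x drop[OF fin[of x]] degree_card_neighbours[OF HD, of x] by (simp add: H_def)
  qed
  \<comment> \<open>The degrees in H add up to 4|H| - 6, the loss being the three edges to each
    deleted vertex.\<close>
  have edges: "card D + 3 = 2 * card H"
  proof -
    have "(\<Sum>x\<in>H. degree D x) = 2 * card D"
    proof -
      have all: "{e\<in>D. e \<subseteq> H} = D" "{e\<in>D. crosses (\<lambda>x. x \<in> H) e} = {}"
        using HD by (auto simp: simple_graph_def crosses_def)
      show ?thesis using sum_degree[OF HD order_refl] unfolding all by simp
    qed
    moreover have "(\<Sum>x\<in>H. degree D x + of_bool (x \<in> M w) + of_bool (x \<in> M v)) = 4 * card H"
      using degH by simp
    moreover have "(\<Sum>x\<in>H. of_bool (x \<in> M u)) = card (M u)" for u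
      using MH[of u] finV by (simp add: sum_of_bool_eq H_def Int_absorb1)
    ultimately show ?thesis using cardM by (simp add: sum.distrib)
  qed
  obtain r where r: "r \<in> H" using oddH by fastforce
  have star: "(of_nat (c2 2 (insert u H) (D \<union> star u (M u))) :: bit) =
      (\<Sum>T\<in>tree_splits.splits H D. of_bool (crosses (tree_splits.side D r T) (M u)))"
    if u: "u = v \<or> u = w" for u
  proof -
    have "card (M u) = 3" using cardM u by auto
    then obtain a b c where abc: "M u = {a, b, c}" "a \<noteq> b" "b \<noteq> c" "a \<noteq> c" by (auto simp: card_3_iff)
    have "u \<notin> H" using u by (auto simp: H_def)
    then show ?thesis
      unfolding abc(1) using MH[of u] abc by (intro c2_star HD r edges oddH) auto
  qed
  have del: "del_vertex_V V p = insert q H \<and> del_vertex_E E p = D \<union> star q (M q)"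
    if pq: "(p = v \<and> q = w) \<or> (p = w \<and> q = v)" for p q
  proof
    show "del_vertex_V V p = insert q H" using pq v w ne by (auto simp: del_vertex_V_def H_def)
    show "del_vertex_E E p = D \<union> star q (M q)"
    proof (intro set_eqI iffI)
      fix e assume "e \<in> del_vertex_E E p"
      then have e: "e \<in> E" "p \<notin> e" by (auto simp: del_vertex_E_def)
      show "e \<in> D \<union> star q (M q)"
      proof (cases "q \<in> e")
        case True
        from G e(1) obtain x y where xy: "e = {x, y}" "x \<noteq> y" by (rule simple_graph_edgeE)
        with True obtain z where "e = {q, z}" "z \<noteq> q" by auto
        then show ?thesis using e pq by (auto simp: star_def M_def)
      qed (use e pq in \<open>auto simp: D_def\<close>)
    next
      fix e assume "e \<in> D \<union> star q (M q)"
      then show "e \<in> del_vertex_E E p" using pq ne by (auto simp: D_def star_def M_def del_vertex_E_def)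
    qed
  qed
  interpret tree_splits H D r by unfold_locales (use HD r oddH in auto)
  have "(of_nat (c2 2 (del_vertex_V V v) (del_vertex_E E v)) :: bit) =
      of_nat (c2 2 (del_vertex_V V w) (del_vertex_E E w))"
    using star[of v] star[of w] del[of v w] del[of w v] separating_splits_parity[of "M w" "M v"] MH cardM degH
    by simp
  \<comment> \<open>\<open>c2 2\<close> is already reduced modulo 2, so equal parity means
    equality.\<close>
  then show ?thesis unfolding of_nat_bit c2_def by (simp add: of_bool_eq_iff mod_2_eq_odd)
qed

theorem theorem1p2:
  fixes V :: "'a set" and E :: "'a set set" and v w :: 'a
  assumes "simple_graph V E"
    and "connected_graph V E"
    and "regular 4 V E"
    and "odd (card V)"
    and "v \<in> V" and "w \<in> V"
  shows "c2 2 (del_vertex_V V v) (del_vertex_E E v) = c2 2 (del_vertex_V V w) (del_vertex_E E w)"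
proof -
  let ?c = "\<lambda>u. c2 2 (del_vertex_V V u) (del_vertex_E E u)"
  have "conn E v w" using assms by (simp add: connected_graph_def conn_def)
  then have "w \<in> V \<and> ?c v = ?c w"
  proof (induction rule: conn_induct)
    case (step y z)
    then have "z \<in> V" using simple_graph_neighbour[OF assms(1)] by blast
    then show ?case using step c2_adjacent[OF assms(1,3,4), of y z] by simp
  qed (use assms in simp)
  then show ?thesis by blast
qed

end
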